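(* Let $G$ be a connected $(c,d)$-biregular simple graph with $c,d\ge2$ and $(c,d)\ne(2,2)$, which is not $K_{2,3}$, $K_{2,4}$, $K_{2,5}$, or $K_{3,3}$. Then \[ \mathscr{K}_e(G)>\mathscr{K}_{nb}(G). \]
   Context: A $(c,d)$-biregular graph is a bipartite graph in which every vertex in one part of the bipartition has degree $c$ and every vertex in the other part has degree $d$. Kemeny's constant of an irreducible finite Markov chain with transition matrix $P$ whose eigenvalues (with multiplicity) are $1=\rho_1,\rho_2,\dots,\rho_N$ (with $1$ simple) is $\mathscr{K}(P)=\sum_{i=2}^{N}\frac{1}{1-\rho_i}$. Arcs of $G$: for each edge $\{u,v\}$ the two ordered pairs $(u,v),(v,u)$. $\mathscr{K}_e(G)$ is Kemeny's constant of the chain on arcs where from $(u,v)$ one moves to $(v,w)$ with probability $1/\deg(v)$ for each neighbor $w$ of $v$. $\mathscr{K}_{nb}(G)$ is Kemeny's constant of the non-backtracking chain on arcs where from $(u,v)$ one moves to $(v,w)$ with probability $1/(\deg(v)-1)$ for each neighbor $w\neq u$ of $v$. *)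

theory Defs
  imports "HOL-Analysis.Analysis" "Jordan_Normal_Form.Char_Poly"
begin

text \<open>A finite simple graph on vertex set V, given by its (symmetric, irreflexive)
  arc set E: (u,v) \<in> E iff {u,v} is an edge. The arcs of the graph are exactly E.\<close>

definition simple_graph :: "'a set \<Rightarrow> ('a \<times> 'a) set \<Rightarrow> bool" where
  "simple_graph V E \<longleftrightarrow> finite V \<and> E \<subseteq> V \<times> V \<and> sym E \<and> (\<forall>v. (v, v) \<notin> E)"

definition nbrs :: "('a \<times> 'a) set \<Rightarrow> 'a \<Rightarrow> 'a set" where
  "nbrs E v = {w. (v, w) \<in> E}"

definition deg :: "('a \<times> 'a) set \<Rightarrow> 'a \<Rightarrow> nat" where
  "deg E v = card (nbrs E v)"

definition connected_graph :: "'a set \<Rightarrow> ('a \<times> 'a) set \<Rightarrow> bool" where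
  "connected_graph V E \<longleftrightarrow> V \<noteq> {} \<and> (\<forall>u\<in>V. \<forall>v\<in>V. (u, v) \<in> E\<^sup>*)"

text \<open>(c,d)-biregular: bipartite with parts X, Y, degree c on X and d on Y.\<close>
definition biregular :: "nat \<Rightarrow> nat \<Rightarrow> 'a set \<Rightarrow> ('a \<times> 'a) set \<Rightarrow> bool" where
  "biregular c d V E \<longleftrightarrow> (\<exists>X Y. X \<union> Y = V \<and> X \<inter> Y = {} \<and>
      (\<forall>(u, v)\<in>E. (u \<in> X \<and> v \<in> Y) \<or> (u \<in> Y \<and> v \<in> X)) \<and>
      (\<forall>x\<in>X. deg E x = c) \<and> (\<forall>y\<in>Y. deg E y = d))"

text \<open>The graph (V,E) is isomorphic to the complete bipartite graph K_{m,n}.\<close>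
definition is_complete_bipartite :: "nat \<Rightarrow> nat \<Rightarrow> 'a set \<Rightarrow> ('a \<times> 'a) set \<Rightarrow> bool" where
  "is_complete_bipartite m n V E \<longleftrightarrow> (\<exists>X Y. X \<union> Y = V \<and> X \<inter> Y = {} \<and>
      card X = m \<and> card Y = n \<and> E = (X \<times> Y) \<union> (Y \<times> X))"

text \<open>Matrix of a transition function on a finite state set S (w.r.t. some enumeration of S).\<close>
definition enum_states :: "'s set \<Rightarrow> 's list" where
  "enum_states S = (SOME xs. distinct xs \<and> set xs = S)"

definition trans_mat :: "'s set \<Rightarrow> ('s \<Rightarrow> 's \<Rightarrow> real) \<Rightarrow> complex mat" where
  "trans_mat S P = (let xs = enum_states S in
     mat (length xs) (length xs) (\<lambda>(i, j). complex_of_real (P (xs ! i) (xs ! j))))"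

text \<open>Kemeny's constant: sum of 1/(1-\<rho>) over all eigenvalues \<rho> counted with (algebraic)
  multiplicity, omitting the (simple) eigenvalue 1. The value is real (non-real
  eigenvalues come in conjugate pairs); we take the real part.\<close>
definition kemeny :: "'s set \<Rightarrow> ('s \<Rightarrow> 's \<Rightarrow> real) \<Rightarrow> real" where
  "kemeny S P = (let p = char_poly (trans_mat S P) in
     Re (\<Sum>\<rho> \<in> {\<rho>. poly p \<rho> = 0} - {1}. of_nat (order \<rho> p) / (1 - \<rho>)))"

text \<open>Simple random walk on arcs: (u,v) \<rightarrow> (v,w) with probability 1/deg v.\<close>
definition edge_walk :: "('a \<times> 'a) set \<Rightarrow> ('a \<times> 'a) \<Rightarrow> ('a \<times> 'a) \<Rightarrow> real" where
  "edge_walk E a b = (if snd a = fst b \<and> b \<in> E then 1 / real (deg E (snd a)) else 0)"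

text \<open>Non-backtracking walk: (u,v) \<rightarrow> (v,w), w \<noteq> u, with probability 1/(deg v - 1).\<close>
definition nb_walk :: "('a \<times> 'a) set \<Rightarrow> ('a \<times> 'a) \<Rightarrow> ('a \<times> 'a) \<Rightarrow> real" where
  "nb_walk E a b = (if snd a = fst b \<and> b \<in> E \<and> snd b \<noteq> fst a
      then 1 / (real (deg E (snd a)) - 1) else 0)"

definition kemeny_e :: "('a \<times> 'a) set \<Rightarrow> real" where
  "kemeny_e E = kemeny E (edge_walk E)"

definition kemeny_nb :: "('a \<times> 'a) set \<Rightarrow> real" where
  "kemeny_nb E = kemeny E (nb_walk E)"

end

theory Submission
  imports Defs
begin

text \<open>
  A (c,d)-biregular graph splits both arc walks into two alternating half-steps, so x enters their
  characteristic polynomials only through x^2, and Sylvester's determinant identity moves the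
  remaining determinant from edges to the vertices of one part Y. There both become products over
  the eigenvalues t of the codegree matrix T of Y. Kemeny's constant is additive over factors of
  the characteristic polynomial and is the logarithmic derivative at 1 of a factor that does not
  vanish there. Writing q for the size of Y and W = (c-1)(d-1) - 1 = c d - c - d, this gives

  (K_e - K_nb) / 2 = (c + d) S - q/d - 1/W,

  where S is the sum of 1 / (c d - t) over all eigenvalues t of T except the Perron eigenvalue c d.
  Since T is positive semidefinite, S is at least (q - 1) / (c d), which leaves
  q/c - 1/c - 1/d - 1/W. The number q/c is 1 exactly for the complete bipartite graph, and the
  bound is positive apart from the excluded cases.
\<close>

subsection \<open>Determinants indexed by lists\<close>

text \<open>The non-backtracking walk is the harder half. Let A and B be the 0/1 matrices on edges
  that record a common end in X and a common end in Y. Two steps of the simple walk give B A / (c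
  d), which factors through Y at once. Two steps of the non-backtracking walk give (B - I)(A - I) /
  s with s = (c-1)(d-1), and with \<kappa> = s x^2 - 1 the determinant to compute is that of
  \<kappa> I + A + B - B A, where A alone does not factor through Y. Since A^2 = c A, the matrix
  (\<kappa> + c) I - A inverts \<kappa> I + A up to the scalar \<kappa> (\<kappa> + c); multiplying
  by it leaves a multiple of I plus B times a matrix, and this does factor through Y. The constant W
  is the value of \<kappa> at x = 1. An eigenvalue t contributes 2 c d / (c d - t) to one constant
  and 2 + 2 W / (c d - t) to the other, so the same sum S governs both, with coefficients 2 c d and
  2 W. As c d - W = c + d is positive, a lower bound on S is all that the comparison
  requires.\<close>

definition fmat :: "'i list \<Rightarrow> 'j list \<Rightarrow> ('i \<Rightarrow> 'j \<Rightarrow> 'r) \<Rightarrow> 'r mat" where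
  "fmat xs ys f = mat (length xs) (length ys) (\<lambda>(i, j). f (xs ! i) (ys ! j))"

abbreviation fdet :: "'i list \<Rightarrow> ('i \<Rightarrow> 'i \<Rightarrow> 'r::comm_ring_1) \<Rightarrow> 'r" where
  "fdet xs f \<equiv> det (fmat xs xs f)"

lemma fmat_carrier [simp]: "fmat xs ys f \<in> carrier_mat (length xs) (length ys)"
  by (simp add: fmat_def)

lemma fmat_dim [simp]: "dim_row (fmat xs ys f) = length xs" "dim_col (fmat xs ys f) = length ys"
  by (simp_all add: fmat_def)

lemma fmat_index [simp]:
  "i < length xs \<Longrightarrow> j < length ys \<Longrightarrow> fmat xs ys f $$ (i, j) = f (xs ! i) (ys ! j)"
  by (simp add: fmat_def)

lemma fmat_cong:
  assumes "\<And>x y. x \<in> set xs \<Longrightarrow> y \<in> set ys \<Longrightarrow> f x y = g x y"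
  shows "fmat xs ys f = fmat xs ys g"
  using assms by (intro eq_matI) auto

lemma fmat_mult:
  fixes f :: "'i \<Rightarrow> 'j \<Rightarrow> 'r::semiring_0"
  assumes "distinct ys"
  shows "fmat xs ys f * fmat ys zs g = fmat xs zs (\<lambda>x z. \<Sum>y\<in>set ys. f x y * g y z)"
proof (intro eq_matI)
  fix i j assume "i < dim_row (fmat xs zs (\<lambda>x z. \<Sum>y\<in>set ys. f x y * g y z))"
    "j < dim_col (fmat xs zs (\<lambda>x z. \<Sum>y\<in>set ys. f x y * g y z))"
  then show "(fmat xs ys f * fmat ys zs g) $$ (i, j)
      = fmat xs zs (\<lambda>x z. \<Sum>y\<in>set ys. f x y * g y z) $$ (i, j)"
    using sum.reindex_bij_betw[OF bij_betw_nth[OF assms refl refl],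
        of "\<lambda>y. f (xs ! i) y * g y (zs ! j)"]
    by (simp add: scalar_prod_def lessThan_atLeast0)
qed auto

lemma fdet_mult:
  assumes "distinct xs"
  shows "fdet xs f * fdet xs g = fdet xs (\<lambda>x z. \<Sum>y\<in>set xs. f x y * g y z)"
  by (subst fmat_mult[OF assms, symmetric], subst det_mult[of _ "length xs"]) auto

lemma fdet_scale: "fdet xs (\<lambda>x y. k * f x y) = k ^ length xs * fdet xs f"
proof -
  have "fmat xs xs (\<lambda>x y. k * f x y) = k \<cdot>\<^sub>m fmat xs xs f"
    by (intro eq_matI) auto
  then show ?thesis by simp
qed

lemma fmat_id: "distinct xs \<Longrightarrow> fmat xs xs (\<lambda>x y. of_bool (x = y)) = 1\<^sub>m (length xs)"
  by (intro eq_matI) (auto simp: nth_eq_iff_index_eq)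

lemma fmat_scalar:
  "distinct xs \<Longrightarrow> fmat xs xs (\<lambda>x y. k * of_bool (x = y)) = k \<cdot>\<^sub>m 1\<^sub>m (length xs)"
  by (intro eq_matI) (auto simp: nth_eq_iff_index_eq)

lemma fmat_map: "fmat (map g xs) (map h ys) f = fmat xs ys (\<lambda>x y. f (g x) (h y))"
  by (intro eq_matI) auto

lemma fmat_append:
  "fmat (xs @ ys) (xs @ ys) f
    = four_block_mat (fmat xs xs f) (fmat xs ys f) (fmat ys xs f) (fmat ys ys f)"
  by (intro eq_matI) (auto simp: nth_append)

lemma sum_of_bool_eq_mult:
  fixes f :: "'i \<Rightarrow> 'r::semiring_1"
  assumes "finite S"
  shows "(\<Sum>y\<in>S. of_bool (x = y) * f y) = of_bool (x \<in> S) * f x"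
    "(\<Sum>y\<in>S. of_bool (y = x) * f y) = of_bool (x \<in> S) * f x"
    "(\<Sum>y\<in>S. f y * of_bool (x = y)) = f x * of_bool (x \<in> S)"
    "(\<Sum>y\<in>S. f y * of_bool (y = x)) = f x * of_bool (x \<in> S)"
  using assms by (simp_all add: of_bool_def if_distrib if_distribR sum.delta sum.delta' cong: if_cong)

text \<open>\<open>enum_states\<close> picks an arbitrary order of the arcs, while the block
  computations need all edges first and their reversals after them. The 0/1 matrix with rows
  \<open>xs\<close> and columns \<open>ys\<close> is a permutation matrix, and conjugating by it
  changes the order.\<close>

lemma fdet_reorder:
  fixes f :: "'i \<Rightarrow> 'i \<Rightarrow> 'r::comm_ring_1"
  assumes xs: "distinct xs" and ys: "distinct ys" and set: "set xs = set ys"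
  shows "fdet xs f = fdet ys f"
proof -
  let ?d = "\<lambda>x y. of_bool (x = y) :: 'r"
  have len: "length xs = length ys"
    using assms by (metis distinct_card)
  have "fmat xs ys ?d * fmat ys xs ?d = 1\<^sub>m (length xs)"
    unfolding fmat_mult[OF ys] fmat_id[OF xs, symmetric]
    by (intro fmat_cong) (simp add: set[symmetric] sum_of_bool_eq_mult)
  then have one: "det (fmat xs ys ?d) * det (fmat ys xs ?d) = 1"
    using det_mult[of "fmat xs ys ?d" "length xs" "fmat ys xs ?d"] len
    by (metis det_one fmat_carrier)
  have "fmat xs xs f = fmat xs ys ?d * (fmat ys ys f * fmat ys xs ?d)"
    unfolding fmat_mult[OF ys]
    by (intro fmat_cong) (simp add: set[symmetric] sum_of_bool_eq_mult)
  then have "fdet xs f = det (fmat xs ys ?d) * (fdet ys f * det (fmat ys xs ?d))"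
    using det_mult[of "fmat xs ys ?d" "length xs"] det_mult[of "fmat ys ys f" "length xs"] len
    by (metis fmat_carrier mult_carrier_mat)
  then show ?thesis
    using one by (metis mult.assoc mult.commute mult_1)
qed

text \<open>Both sides arise from multiplying the block matrix with rows (k I, A) and (B, I) by a
  block triangular matrix, on the right and on the left respectively.\<close>
lemma det_sylvester:
  fixes A B :: "'r::idom mat"
  assumes A: "A \<in> carrier_mat n m" and B: "B \<in> carrier_mat m n"
  shows "k ^ m * det (k \<cdot>\<^sub>m 1\<^sub>m n - A * B) = k ^ n * det (k \<cdot>\<^sub>m 1\<^sub>m m - B * A)"
proof -
  let ?M = "four_block_mat (k \<cdot>\<^sub>m 1\<^sub>m n) A B (1\<^sub>m m)"
  let ?R = "four_block_mat (1\<^sub>m n) (0\<^sub>m n m) (- B) (1\<^sub>m m)"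
  let ?L = "four_block_mat (1\<^sub>m n) (0\<^sub>m n m) (- B) (k \<cdot>\<^sub>m 1\<^sub>m m)"
  have M: "?M \<in> carrier_mat (n + m) (n + m)" and R: "?R \<in> carrier_mat (n + m) (n + m)"
    and L: "?L \<in> carrier_mat (n + m) (n + m)"
    using A B by auto
  have "?M * ?R = four_block_mat (k \<cdot>\<^sub>m 1\<^sub>m n - A * B) A (0\<^sub>m m n) (1\<^sub>m m)"
    by (subst mult_four_block_mat[of _ n n _ m _ m _ _ n _ m])
      (use A B in \<open>auto intro!: cong_four_block_mat eq_matI\<close>)
  then have "det ?M * det ?R = det (k \<cdot>\<^sub>m 1\<^sub>m n - A * B)"
    using A B by (subst det_mult[OF M R, symmetric])
      (simp add: det_four_block_mat_lower_left_zero[of _ n _ m] minus_carrier_mat)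
  moreover have "det ?R = 1"
    using B by (subst det_four_block_mat_upper_right_zero[of _ n _ m]) auto
  ultimately have 1: "det ?M = det (k \<cdot>\<^sub>m 1\<^sub>m n - A * B)" by simp
  have "?L * ?M = four_block_mat (k \<cdot>\<^sub>m 1\<^sub>m n) A (0\<^sub>m m n) (k \<cdot>\<^sub>m 1\<^sub>m m - B * A)"
    by (subst mult_four_block_mat[of _ n n _ m _ m _ _ n _ m])
      (use A B in \<open>auto intro!: cong_four_block_mat eq_matI\<close>)
  then have "det ?L * det ?M = k ^ n * det (k \<cdot>\<^sub>m 1\<^sub>m m - B * A)"
    using A B by (subst det_mult[OF L M, symmetric])
      (simp add: det_four_block_mat_lower_left_zero[of _ n _ m] minus_carrier_mat)
  moreover have "det ?L = k ^ m"
    using B by (subst det_four_block_mat_upper_right_zero[of _ n _ m]) auto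
  ultimately show ?thesis using 1 by simp
qed

text \<open>Keeping a power of \<open>k\<close> on each side makes the identity hold at
  \<open>k = 0\<close> too, whichever list is longer. It is applied with \<open>k\<close> replaced
  by values of polynomials, which do vanish at some points.\<close>

lemma fdet_sylvester:
  fixes a :: "'i \<Rightarrow> 'j \<Rightarrow> 'r::idom"
  assumes xs: "distinct xs" and ys: "distinct ys"
  shows "k ^ length ys * fdet xs (\<lambda>x z. k * of_bool (x = z) - (\<Sum>y\<in>set ys. a x y * b y z))
    = k ^ length xs * fdet ys (\<lambda>y z. k * of_bool (y = z) - (\<Sum>x\<in>set xs. b y x * a x z))"
proof -
  have "k \<cdot>\<^sub>m 1\<^sub>m (length xs) - fmat xs ys a * fmat ys xs b
      = fmat xs xs (\<lambda>x z. k * of_bool (x = z) - (\<Sum>y\<in>set ys. a x y * b y z))"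
    unfolding fmat_mult[OF ys] fmat_scalar[OF xs, symmetric] by (intro eq_matI) auto
  moreover have "k \<cdot>\<^sub>m 1\<^sub>m (length ys) - fmat ys xs b * fmat xs ys a
      = fmat ys ys (\<lambda>y z. k * of_bool (y = z) - (\<Sum>x\<in>set xs. b y x * a x z))"
    unfolding fmat_mult[OF xs] fmat_scalar[OF ys, symmetric] by (intro eq_matI) auto
  ultimately show ?thesis
    using det_sylvester[of "fmat xs ys a" "length xs" "length ys" "fmat ys xs b" k] by simp
qed

text \<open>Both diagonal blocks are \<open>k\<close> times the identity, so the lower blocks
  commute and the block determinant is that of the product of the diagonal blocks minus the product
  of the other two. This is where \<open>k\<close> starts to occur only as its square.\<close>

lemma fdet_bipartite:
  fixes f :: "'i \<Rightarrow> 'i \<Rightarrow> 'r::idom"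
  assumes xs: "distinct xs" and g: "inj_on g (set xs)"
    and xx: "\<And>x y. x \<in> set xs \<Longrightarrow> y \<in> set xs \<Longrightarrow> f x y = 0 \<and> f (g x) (g y) = 0"
    and disj: "set xs \<inter> g ` set xs = {}"
  shows "fdet (xs @ map g xs) (\<lambda>x y. k * of_bool (x = y) - f x y)
    = fdet xs (\<lambda>x z. k\<^sup>2 * of_bool (x = z) - (\<Sum>y\<in>set xs. f x (g y) * f (g y) z))"
proof -
  let ?n = "length xs"
  let ?B = "fmat xs xs (\<lambda>x y. - f x (g y))" and ?C = "fmat xs xs (\<lambda>x y. - f (g x) y)"
  have A: "fmat xs xs (\<lambda>x y. k * of_bool (x = y) - f x y) = k \<cdot>\<^sub>m 1\<^sub>m ?n"
    unfolding fmat_scalar[OF xs, symmetric] by (intro fmat_cong) (simp add: xx)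
  have D: "fmat (map g xs) (map g xs) (\<lambda>x y. k * of_bool (x = y) - f x y) = k \<cdot>\<^sub>m 1\<^sub>m ?n"
    unfolding fmat_scalar[OF xs, symmetric] fmat_map
    by (intro fmat_cong) (use g in \<open>auto simp: xx dest: inj_onD\<close>)
  have B: "fmat xs (map g xs) (\<lambda>x y. k * of_bool (x = y) - f x y) = ?B"
    unfolding fmat_map[of id xs g xs, simplified] by (intro fmat_cong) (use disj in auto)
  have C: "fmat (map g xs) xs (\<lambda>x y. k * of_bool (x = y) - f x y) = ?C"
    unfolding fmat_map[of g xs id xs, simplified] by (intro fmat_cong) (use disj in auto)
  have "fdet (xs @ map g xs) (\<lambda>x y. k * of_bool (x = y) - f x y)
      = det ((k \<cdot>\<^sub>m 1\<^sub>m ?n) * (k \<cdot>\<^sub>m 1\<^sub>m ?n) - ?B * ?C)"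
    unfolding fmat_append A B C D
    by (subst det_four_block_mat[of _ ?n]) auto
  also have "(k \<cdot>\<^sub>m 1\<^sub>m ?n) * (k \<cdot>\<^sub>m 1\<^sub>m ?n) - ?B * ?C
      = fmat xs xs (\<lambda>x z. k\<^sup>2 * of_bool (x = z) - (\<Sum>y\<in>set xs. f x (g y) * f (g y) z))"
    unfolding fmat_mult[OF xs]
    by (intro eq_matI) (auto simp: nth_eq_iff_index_eq[OF xs] power2_eq_square)
  finally show ?thesis .
qed

lemma enum_states:
  assumes "finite S"
  shows "distinct (enum_states S)" "set (enum_states S) = S"
  using someI_ex[OF finite_distinct_list[OF assms, unfolded conj_commute[of "set _ = S"]]]
  unfolding enum_states_def by auto

section \<open>Characteristic polynomials and eigenfunctions of labelled matrices\<close>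

lemma poly_char_poly_fmat:
  fixes f :: "'i \<Rightarrow> 'i \<Rightarrow> 'r::field"
  assumes "distinct xs"
  shows "poly (char_poly (fmat xs xs f)) k = fdet xs (\<lambda>x y. k * of_bool (x = y) - f x y)"
  unfolding char_poly_matrix[OF fmat_carrier] char_matrix_def
  by (intro arg_cong[of _ _ det] eq_matI)
    (auto simp: nth_eq_iff_index_eq[OF assms])

lemma trans_mat_fmat:
  "trans_mat S P = fmat (enum_states S) (enum_states S) (\<lambda>x y. complex_of_real (P x y))"
  by (simp add: trans_mat_def fmat_def Let_def)

lemma fmat_eigenfunction:
  fixes f :: "'i \<Rightarrow> 'i \<Rightarrow> 'r::field"
  assumes xs: "distinct xs" and root: "poly (char_poly (fmat xs xs f)) \<tau> = 0"
  obtains v where "\<exists>x\<in>set xs. v x \<noteq> 0"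
    "\<And>x. x \<in> set xs \<Longrightarrow> (\<Sum>y\<in>set xs. f x y * v y) = \<tau> * v x"
proof -
  obtain w where w: "w \<in> carrier_vec (length xs)" "w \<noteq> 0\<^sub>v (length xs)"
    "fmat xs xs f *\<^sub>v w = \<tau> \<cdot>\<^sub>v w"
    using root eigenvalue_root_char_poly[OF fmat_carrier[of xs xs f]]
    by (auto simp: eigenvalue_def eigenvector_def)
  define v where "v x = w $ the_inv_into {..<length xs} ((!) xs) x" for x
  have bij: "bij_betw ((!) xs) {..<length xs} (set xs)"
    by (rule bij_betw_nth[OF xs refl refl])
  have v: "v (xs ! i) = w $ i" if "i < length xs" for i
    using the_inv_into_f_f[of "(!) xs" "{..<length xs}" i] bij that
    by (simp add: v_def bij_betw_def)
  show thesis
  proof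
    obtain i where "i < length xs" "w $ i \<noteq> 0"
      using w(1,2) by (metis carrier_vecD eq_vecI index_zero_vec)
    then show "\<exists>x\<in>set xs. v x \<noteq> 0"
      by (metis nth_mem v)
  next
    fix x assume "x \<in> set xs"
    then obtain i where i: "i < length xs" "x = xs ! i"
      by (auto simp: in_set_conv_nth)
    have "(\<Sum>y\<in>set xs. f x y * v y) = (\<Sum>j<length xs. f (xs ! i) (xs ! j) * w $ j)"
      using sum.reindex_bij_betw[OF bij, of "\<lambda>y. f x y * v y"] i by (simp add: v)
    also have "\<dots> = (fmat xs xs f *\<^sub>v w) $ i"
      using i w(1) by (simp add: scalar_prod_def lessThan_atLeast0)
    also have "\<dots> = \<tau> * v x"
      using i w by (simp add: v)
    finally show "(\<Sum>y\<in>set xs. f x y * v y) = \<tau> * v x" .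
  qed
qed

text \<open>The homogeneous form of the characteristic polynomial: one list of eigenvalues serves
  both walks, whose pairs of coefficients \<alpha>, \<beta> depend differently on the spectral
  variable.\<close>

lemma fdet_linear_factor:
  fixes f :: "'i \<Rightarrow> 'i \<Rightarrow> complex"
  assumes xs: "distinct xs" and fac: "char_poly (fmat xs xs f) = (\<Prod>t\<leftarrow>ts. [:- t, 1:])"
    and len: "length ts = length xs"
  shows "fdet xs (\<lambda>x y. \<alpha> * of_bool (x = y) - \<beta> * f x y) = (\<Prod>t\<leftarrow>ts. \<alpha> - \<beta> * t)"
proof (cases "\<beta> = 0")
  case True
  then show ?thesis
    using len by (simp add: fmat_scalar[OF xs] map_replicate_const prod_list_replicate)
next
  case False
  have "fdet xs (\<lambda>x y. \<alpha> * of_bool (x = y) - \<beta> * f x y)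
      = fdet xs (\<lambda>x y. \<beta> * (\<alpha> / \<beta> * of_bool (x = y) - f x y))"
    using False by (simp add: right_diff_distrib)
  also have "\<dots> = \<beta> ^ length ts * poly (\<Prod>t\<leftarrow>ts. [:- t, 1:]) (\<alpha> / \<beta>)"
    unfolding fdet_scale poly_char_poly_fmat[OF xs, symmetric] fac len ..
  also have "\<dots> = (\<Prod>t\<leftarrow>ts. \<alpha> - \<beta> * t)"
    using False by (induction ts) (simp_all add: poly_prod_list field_simps)
  finally show ?thesis .
qed

subsection \<open>Kemeny's constant as a functional on polynomials\<close>

text \<open>Stated for arbitrary polynomials so that it can be evaluated factor by factor. A root 1
  is skipped whatever its multiplicity, so additivity over products needs no condition at 1.\<close>

definition kemeny_poly :: "complex poly \<Rightarrow> complex" where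
  "kemeny_poly p = (\<Sum>\<rho>\<in>{\<rho>. poly p \<rho> = 0} - {1}. of_nat (order \<rho> p) / (1 - \<rho>))"

lemma kemeny_poly_superset:
  assumes "p \<noteq> 0" "finite S" "{\<rho>. poly p \<rho> = 0} \<subseteq> S"
  shows "kemeny_poly p = (\<Sum>\<rho>\<in>S - {1}. of_nat (order \<rho> p) / (1 - \<rho>))"
  unfolding kemeny_poly_def
  by (intro sum.mono_neutral_left) (use assms in \<open>auto simp: order_root\<close>)

lemma kemeny_poly_mult:
  assumes "p \<noteq> 0" "q \<noteq> 0"
  shows "kemeny_poly (p * q) = kemeny_poly p + kemeny_poly q"
proof -
  let ?S = "{\<rho>. poly (p * q) \<rho> = 0}"
  have pq: "p * q \<noteq> 0" and fin: "finite ?S"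
    using assms poly_roots_finite[of "p * q"] by auto
  show ?thesis
    using assms pq kemeny_poly_superset[of p ?S] kemeny_poly_superset[of q ?S] fin
    by (simp add: kemeny_poly_def[of "p * q"] order_mult sum.distrib add_divide_distrib subset_iff)
qed

lemma kemeny_poly_power: "p \<noteq> 0 \<Longrightarrow> kemeny_poly (p ^ n) = of_nat n * kemeny_poly p"
  by (induction n) (auto simp: kemeny_poly_mult algebra_simps kemeny_poly_def[of 1])

lemma kemeny_poly_prod_list:
  "0 \<notin> set ps \<Longrightarrow> kemeny_poly (prod_list ps) = (\<Sum>p\<leftarrow>ps. kemeny_poly p)"
  by (induction ps) (auto simp: kemeny_poly_mult prod_list_zero_iff kemeny_poly_def[of 1])

lemma kemeny_poly_linear: "kemeny_poly [:- r, 1:] = (if r = 1 then 0 else 1 / (1 - r))"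
proof -
  have "{\<rho>. poly [:- r, 1:] \<rho> = 0} = {r}" by auto
  moreover have "order r [:- r, 1:] = 1"
    using order_power_n_n[of r 1] by simp
  ultimately show ?thesis unfolding kemeny_poly_def by auto
qed

lemma kemeny_poly_const: "k \<noteq> 0 \<Longrightarrow> kemeny_poly [:k:] = 0"
  by (simp add: kemeny_poly_def)

text \<open>For a product of linear factors p'/p at 1 is the sum of 1 / (1 - a) over the roots a.
  Hence the quartic factors of the non-backtracking walk can be evaluated without solving for their
  roots.\<close>

lemma kemeny_poly_eq_logderiv:
  assumes "poly p 1 \<noteq> 0"
  shows "kemeny_poly p = poly (pderiv p) 1 / poly p 1"
proof -
  have lin: "kemeny_poly (\<Prod>a\<leftarrow>as. [:- a, 1:]) = poly (pderiv (\<Prod>a\<leftarrow>as. [:- a, 1:])) 1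
      / poly (\<Prod>a\<leftarrow>as. [:- a, 1:]) 1" if "1 \<notin> set as" for as :: "complex list"
    using that
  proof (induction as)
    case Nil
    then show ?case by (simp add: kemeny_poly_def)
  next
    case (Cons a as)
    have "(\<Prod>a\<leftarrow>as. [:- a, 1:]) \<noteq> 0" "poly (\<Prod>a\<leftarrow>as. [:- a, 1:]) 1 \<noteq> 0"
      using Cons.prems by (auto simp: prod_list_zero_iff poly_prod_list)
    with Cons show ?case
      by (simp add: kemeny_poly_mult kemeny_poly_linear pderiv_mult pderiv_pCons field_simps del: mult_pCons_left)
  qed
  obtain as where as: "Polynomial.smult (lead_coeff p) (\<Prod>a\<leftarrow>as. [:- a, 1:]) = p"
    using fundamental_theorem_algebra_factorized[of p] by blast
  have lc: "lead_coeff p \<noteq> 0" using assms by auto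
  have "poly (\<Prod>a\<leftarrow>as. [:- a, 1:]) 1 \<noteq> 0"
    using assms by (metis as mult_zero_right poly_smult)
  then have "1 \<notin> set as" "(\<Prod>a\<leftarrow>as. [:- a, 1:]) \<noteq> 0"
    by (auto simp: poly_prod_list prod_list_zero_iff)
  moreover have "p = [:lead_coeff p:] * (\<Prod>a\<leftarrow>as. [:- a, 1:])"
    using as by simp
  ultimately have "kemeny_poly p = kemeny_poly (\<Prod>a\<leftarrow>as. [:- a, 1:])"
    using lc by (metis kemeny_poly_const kemeny_poly_mult add_0 pCons_eq_0_iff)
  also have "\<dots> = poly (pderiv p) 1 / poly p 1"
    using lc lin[OF \<open>1 \<notin> set as\<close>] by (subst (1 2) as[symmetric]) (simp add: pderiv_smult)
  finally show ?thesis .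
qed

lemma kemeny_eq_kemeny_poly: "kemeny S P = Re (kemeny_poly (char_poly (trans_mat S P)))"
  by (simp add: kemeny_def kemeny_poly_def Let_def)

lemma kemeny_poly_even_quadratic:
  assumes "a + b \<noteq> 0"
  shows "kemeny_poly [:a, 0, b:] = 2 * b / (a + b)"
  using assms by (subst kemeny_poly_eq_logderiv) (simp_all add: pderiv_pCons)

lemma kemeny_poly_square_minus_one: "kemeny_poly [:- 1, 0, 1:] = 1 / 2"
proof -
  have "kemeny_poly ([:- 1, 1:] * [:- (- 1), 1:]) = kemeny_poly [:- 1, 1:] + kemeny_poly [:- (- 1), 1:]"
    by (rule kemeny_poly_mult) auto
  also have "\<dots> = 1 / 2"
    unfolding kemeny_poly_linear by simp
  finally show ?thesis by simp
qed

text \<open>In both walks an eigenvalue \<open>r\<close> contributes a constant plus a multiple of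
  \<open>1 / (n - r)\<close>; this common shape is what lets one sum express both constants.\<close>

lemma sum_list_map_of_real:
  assumes "\<And>r. r \<in> set rs \<Longrightarrow> f (complex_of_real r) = complex_of_real (a + b * (1 / (n - r)))"
  shows "(\<Sum>t\<leftarrow>map complex_of_real rs. f t)
    = complex_of_real (real (length rs) * a + b * (\<Sum>r\<leftarrow>rs. 1 / (n - r)))"
  using assms by (induction rs) (simp_all add: algebra_simps)

lemma zero_notin_set_map_poly:
  assumes "\<And>x. x \<in> set xs \<Longrightarrow> poly (f x) a \<noteq> 0"
  shows "0 \<notin> set (map f xs)"
proof
  assume "0 \<in> set (map f xs)"
  then obtain x where "x \<in> set xs" "f x = 0" by auto
  then show False using assms[of x] by simp
qed

subsection \<open>The spectrum of the codegree matrix\<close>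

locale biregular_graph =
  fixes X Y :: "'a set" and E :: "('a \<times> 'a) set" and c d :: nat
  assumes finite_X: "finite X" and finite_Y: "finite Y" and disjoint: "X \<inter> Y = {}"
    and sym_E: "sym E" and bipartite: "E \<subseteq> X \<times> Y \<union> Y \<times> X"
    and deg_X: "x \<in> X \<Longrightarrow> deg E x = c" and deg_Y: "y \<in> Y \<Longrightarrow> deg E y = d"
    and connected: "u \<in> X \<union> Y \<Longrightarrow> v \<in> X \<union> Y \<Longrightarrow> (u, v) \<in> E\<^sup>*"
    and nonempty: "X \<union> Y \<noteq> {}"
    and c_pos: "c > 0" and d_pos: "d > 0"
begin

section \<open>Degree counts in a biregular graph\<close>

definition adj :: "'a \<Rightarrow> 'a \<Rightarrow> complex" where
  "adj x y = of_bool ((x, y) \<in> E)"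

definition codeg :: "'a \<Rightarrow> 'a \<Rightarrow> complex" where
  "codeg y z = (\<Sum>x\<in>X. adj x y * adj x z)"

definition edges :: "('a \<times> 'a) set" where
  "edges = E \<inter> X \<times> Y"

lemma cnj_adj [simp]: "cnj (adj x y) = adj x y"
  by (simp add: adj_def)

lemma nbrs_X: "x \<in> X \<Longrightarrow> nbrs E x = {y \<in> Y. (x, y) \<in> E}"
  using bipartite disjoint by (auto simp: nbrs_def)

lemma nbrs_Y: "y \<in> Y \<Longrightarrow> nbrs E y = {x \<in> X. (x, y) \<in> E}"
  using bipartite disjoint sym_E by (auto simp: nbrs_def dest: symD)

lemma sum_adj_Y: "x \<in> X \<Longrightarrow> (\<Sum>y\<in>Y. adj x y) = of_nat c"
  using deg_X[of x] finite_Y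
  by (simp add: adj_def deg_def nbrs_X Int_def flip: of_nat_sum)

lemma sum_adj_X: "y \<in> Y \<Longrightarrow> (\<Sum>x\<in>X. adj x y) = of_nat d"
  using deg_Y[of y] finite_X
  by (simp add: adj_def deg_def nbrs_Y Int_def flip: of_nat_sum)

lemma finite_edges: "finite edges"
  using finite_X finite_Y by (simp add: edges_def)

lemma sum_edges: "(\<Sum>e\<in>edges. g (fst e) (snd e)) = (\<Sum>x\<in>X. \<Sum>y\<in>Y. adj x y * g x y)"
proof -
  have "(\<Sum>x\<in>X. \<Sum>y\<in>Y. adj x y * g x y)
      = (\<Sum>e\<in>X \<times> Y. adj (fst e) (snd e) * g (fst e) (snd e))"
    by (simp add: sum.cartesian_product case_prod_beta)
  also have "\<dots> = (\<Sum>e\<in>edges. adj (fst e) (snd e) * g (fst e) (snd e))"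
    by (rule sum.mono_neutral_right) (auto simp: finite_X finite_Y edges_def adj_def)
  also have "\<dots> = (\<Sum>e\<in>edges. g (fst e) (snd e))"
    by (rule sum.cong) (auto simp: edges_def adj_def)
  finally show ?thesis ..
qed

lemma card_edges: "card edges = card X * c" "card edges = card Y * d"
proof -
  have "of_nat (card edges) = (\<Sum>x\<in>X. \<Sum>y\<in>Y. adj x y)"
    using sum_edges[of "\<lambda>_ _. 1"] by simp
  moreover have "\<dots> = of_nat (card X * c)"
    by (simp add: sum_adj_Y)
  moreover have "(\<Sum>x\<in>X. \<Sum>y\<in>Y. adj x y) = of_nat (card Y * d)"
    by (subst sum.swap) (simp add: sum_adj_X)
  ultimately show "card edges = card X * c" "card edges = card Y * d"
    by (metis of_nat_eq_iff)+
qed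

lemma c_le_card_Y: "c \<le> card Y" and d_le_card_X: "d \<le> card X"
proof -
  have "X \<noteq> {} \<and> Y \<noteq> {}"
  proof -
    have "card X * c = card Y * d" using card_edges by simp
    then have "X = {} \<longleftrightarrow> Y = {}"
      using finite_X finite_Y c_pos d_pos by (metis card_0_eq mult_is_0 neq0_conv)
    with nonempty show ?thesis by auto
  qed
  then obtain x y where "x \<in> X" "y \<in> Y" by auto
  then show "c \<le> card Y" "d \<le> card X"
    using deg_X[of x] deg_Y[of y] card_mono[OF finite_Y, of "nbrs E x"]
      card_mono[OF finite_X, of "nbrs E y"]
    by (auto simp: deg_def nbrs_X nbrs_Y)
qed

lemma card_Y_pos: "card Y > 0"
  using c_le_card_Y c_pos by simp

lemma codeg_commute: "codeg y z = codeg z y"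
  by (simp add: codeg_def mult.commute)

lemma sum_codeg: "y \<in> Y \<Longrightarrow> (\<Sum>z\<in>Y. codeg y z) = of_nat (c * d)"
proof -
  assume y: "y \<in> Y"
  have "(\<Sum>z\<in>Y. codeg y z) = (\<Sum>x\<in>X. \<Sum>z\<in>Y. adj x y * adj x z)"
    unfolding codeg_def by (rule sum.swap)
  also have "\<dots> = (\<Sum>x\<in>X. adj x y * of_nat c)"
    by (intro sum.cong refl) (simp add: sum_adj_Y flip: sum_distrib_left)
  also have "\<dots> = of_nat (c * d)"
    unfolding sum_distrib_right[symmetric] sum_adj_X[OF y] by simp
  finally show ?thesis .
qed

lemma sum_edges_snd_eq:
  assumes "y \<in> Y"
  shows "(\<Sum>e\<in>edges. g (fst e) * of_bool (snd e = y)) = (\<Sum>x\<in>X. g x * adj x y)"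
proof -
  have "(\<Sum>z\<in>Y. adj x z * (g x * of_bool (z = y))) = g x * adj x y" for x
  proof -
    have "(\<Sum>z\<in>Y. adj x z * (g x * of_bool (z = y))) = (\<Sum>z\<in>Y. g x * adj x z * of_bool (z = y))"
      by (simp add: mult_ac)
    then show ?thesis
      using assms finite_Y by (simp only: sum_of_bool_eq_mult) simp
  qed
  then show ?thesis
    unfolding sum_edges[of "\<lambda>a b. g a * of_bool (b = y)"] by simp
qed

text \<open>With s(x) the sum of v over the neighbours of x, the quadratic form of the codegree matrix
  is the sum of |s(x)|^2, and c d |v|^2 exceeds it by half the sum of |v(y) - v(z)|^2 over all
  paths y - x - z. The first fact bounds the eigenvalues from below, the second from above.\<close>
lemma codeg_eigenfunction:
  assumes ev: "\<And>y. y \<in> Y \<Longrightarrow> (\<Sum>z\<in>Y. codeg y z * v z) = \<tau> * v y"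
    and nz: "\<exists>y\<in>Y. v y \<noteq> 0"
  obtains r where "\<tau> = of_real r" "0 \<le> r" "r \<le> real (c * d)"
    "r = real (c * d) \<Longrightarrow> \<exists>k. \<forall>y\<in>Y. v y = k"
proof -
  define n where "n = (\<Sum>y\<in>Y. (cmod (v y))\<^sup>2)"
  define s where "s x = (\<Sum>y\<in>Y. adj x y * v y)" for x
  define D where "D = (\<Sum>x\<in>X. \<Sum>y\<in>Y. \<Sum>z\<in>Y. of_bool ((x, y) \<in> E \<and> (x, z) \<in> E) * (cmod (v y - v z))\<^sup>2)"
  have n: "complex_of_real n = (\<Sum>y\<in>Y. v y * cnj (v y))"
    unfolding n_def of_real_sum complex_norm_square ..
  have n_pos: "n > 0"
  proof -
    obtain y where "y \<in> Y" "v y \<noteq> 0" using nz by blast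
    then show ?thesis unfolding n_def by (intro sum_pos2[OF finite_Y]) auto
  qed
  have s2: "complex_of_real (\<Sum>x\<in>X. (cmod (s x))\<^sup>2) = \<tau> * complex_of_real n"
  proof -
    have "\<tau> * complex_of_real n = (\<Sum>y\<in>Y. cnj (v y) * (\<tau> * v y))"
      by (simp add: n sum_distrib_left mult_ac)
    also have "\<dots> = (\<Sum>y\<in>Y. cnj (v y) * (\<Sum>z\<in>Y. codeg y z * v z))"
      by (intro sum.cong) (simp_all add: ev)
    also have "\<dots> = (\<Sum>y\<in>Y. \<Sum>z\<in>Y. \<Sum>x\<in>X. cnj (v y) * adj x y * (adj x z * v z))"
      by (simp add: codeg_def sum_distrib_left sum_distrib_right mult_ac)
    also have "\<dots> = (\<Sum>y\<in>Y. \<Sum>x\<in>X. \<Sum>z\<in>Y. cnj (v y) * adj x y * (adj x z * v z))"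
      by (intro sum.cong refl sum.swap)
    also have "\<dots> = (\<Sum>x\<in>X. \<Sum>y\<in>Y. \<Sum>z\<in>Y. cnj (v y) * adj x y * (adj x z * v z))"
      by (rule sum.swap)
    also have "\<dots> = (\<Sum>x\<in>X. s x * cnj (s x))"
      by (simp add: s_def sum_product sum_distrib_left sum_distrib_right mult_ac)
    finally show ?thesis by (simp only: of_real_sum complex_norm_square)
  qed
  define r where "r = (\<Sum>x\<in>X. (cmod (s x))\<^sup>2) / n"
  have \<tau>: "\<tau> = of_real r"
    using s2 n_pos by (simp add: r_def field_simps)
  have rn: "(\<Sum>x\<in>X. (cmod (s x))\<^sup>2) = r * n"
    using n_pos by (simp add: r_def)
  have Dx: "(\<Sum>y\<in>Y. \<Sum>z\<in>Y. adj x y * adj x z * ((v y - v z) * cnj (v y - v z)))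
     = 2 * of_nat c * (\<Sum>y\<in>Y. adj x y * (v y * cnj (v y))) - 2 * (s x * cnj (s x))" if x: "x \<in> X" for x
  proof -
    have "(\<Sum>y\<in>Y. \<Sum>z\<in>Y. adj x y * adj x z * ((v y - v z) * cnj (v y - v z)))
      = (\<Sum>y\<in>Y. \<Sum>z\<in>Y. (adj x y * (v y * cnj (v y))) * adj x z)
      + (\<Sum>y\<in>Y. \<Sum>z\<in>Y. adj x y * (adj x z * (v z * cnj (v z))))
      - (\<Sum>y\<in>Y. \<Sum>z\<in>Y. (adj x y * v y) * (adj x z * cnj (v z)))
      - (\<Sum>y\<in>Y. \<Sum>z\<in>Y. (adj x y * cnj (v y)) * (adj x z * v z))"
      unfolding sum.distrib[symmetric] sum_subtractf[symmetric]
      by (intro sum.cong refl) (simp add: algebra_simps)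
    then show ?thesis
      by (simp add: s_def sum_adj_Y[OF x] sum_product[symmetric])
  qed
  have "complex_of_real D = (\<Sum>x\<in>X. \<Sum>y\<in>Y. \<Sum>z\<in>Y. adj x y * adj x z * ((v y - v z) * cnj (v y - v z)))"
    unfolding D_def of_real_sum of_real_mult complex_norm_square
    by (intro sum.cong refl) (auto simp: adj_def)
  also have "\<dots> = 2 * of_nat c * (\<Sum>x\<in>X. \<Sum>y\<in>Y. adj x y * (v y * cnj (v y))) - 2 * (\<Sum>x\<in>X. s x * cnj (s x))"
    by (simp only: Dx sum_subtractf sum_distrib_left cong: sum.cong)
  also have "(\<Sum>x\<in>X. \<Sum>y\<in>Y. adj x y * (v y * cnj (v y))) = of_nat d * complex_of_real n"
    by (subst sum.swap) (simp add: n sum_adj_X sum_distrib_left flip: sum_distrib_right)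
  also have "(\<Sum>x\<in>X. s x * cnj (s x)) = complex_of_real (r * n)"
    unfolding rn[symmetric] of_real_sum complex_norm_square ..
  finally have "complex_of_real D = complex_of_real (2 * (real (c * d) - r) * n)"
    by (simp add: algebra_simps)
  then have D: "D = 2 * (real (c * d) - r) * n"
    by (simp only: of_real_eq_iff)
  have D_nonneg: "D \<ge> 0"
    unfolding D_def by (intro sum_nonneg) auto
  show thesis
  proof (rule that[OF \<tau>])
    show "0 \<le> r" unfolding r_def using n_pos by (intro divide_nonneg_pos sum_nonneg) auto
    show "r \<le> real (c * d)"
      using D D_nonneg n_pos by (simp add: zero_le_mult_iff)
    assume "r = real (c * d)"
    then have "D = 0" using D by simp
    have const: "v y = v z" if "x \<in> X" "y \<in> Y" "z \<in> Y" "(x, y) \<in> E" "(x, z) \<in> E" for x y z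
    proof -
      let ?w = "\<lambda>x y z. of_bool ((x, y) \<in> E \<and> (x, z) \<in> E) * (cmod (v y - v z))\<^sup>2"
      have "(\<Sum>y\<in>Y. \<Sum>z\<in>Y. ?w x y z) = 0"
        using \<open>D = 0\<close>[unfolded D_def] that
        by (elim sum_nonneg_0[OF finite_X, rotated]) (auto intro!: sum_nonneg)
      then have "(\<Sum>z\<in>Y. ?w x y z) = 0"
        using that by (elim sum_nonneg_0[OF finite_Y, rotated]) (auto intro!: sum_nonneg)
      then have "?w x y z = 0"
        using that by (elim sum_nonneg_0[OF finite_Y, rotated]) auto
      then show ?thesis using that by simp
    qed
    obtain y0 where y0: "y0 \<in> Y" using nz by auto
    \<comment> \<open>Walks alternate between the parts, but \<open>v\<close> is controlled only on
      Y. The invariant therefore says, at a vertex of X, that all its neighbours already carry the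
      value \<open>v y0\<close>.\<close>
    have "(u \<in> Y \<longrightarrow> v u = v y0) \<and> (u \<in> X \<longrightarrow> (\<forall>y\<in>Y. (u, y) \<in> E \<longrightarrow> v y = v y0))"
      if "(y0, u) \<in> E\<^sup>*" for u
      using that
    proof (induction rule: rtrancl_induct)
      case base
      then show ?case using y0 disjoint by auto
    next
      case (step u w)
      have "(w, u) \<in> E" using step.hyps(2) sym_E by (auto dest: symD)
      moreover have "(u \<in> X \<and> w \<in> Y) \<or> (u \<in> Y \<and> w \<in> X)"
        using step.hyps(2) bipartite by auto
      ultimately show ?case
      proof (elim disjE conjE)
        assume "(w, u) \<in> E" "u \<in> X" "w \<in> Y"
        then have "w \<notin> X" "v w = v y0"
          using step.IH step.hyps(2) disjoint by blast+
        then show ?thesis by blast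
      next
        assume "(w, u) \<in> E" "u \<in> Y" "w \<in> X"
        then have "w \<notin> Y" "v u = v y0" "\<forall>y\<in>Y. (w, y) \<in> E \<longrightarrow> v u = v y"
          using step.IH const disjoint by blast+
        then show ?thesis by metis
      qed
    qed
    then have "v y = v y0" if "y \<in> Y" for y
      using connected[of y0 y] y0 that by (meson UnI2)
    then show "\<exists>k. \<forall>y\<in>Y. v y = k" by (intro exI ballI)
  qed
qed

text \<open>Subtracting the Perron part replaces the eigenvalue c d of the codegree matrix by 0. This
  replaces the algebraic simplicity of c d by the weaker fact that c d is not an eigenvalue of the
  deflated matrix.\<close>
definition codeg0 :: "'a \<Rightarrow> 'a \<Rightarrow> complex" where
  "codeg0 y z = codeg y z - of_nat (c * d) / of_nat (card Y)"

lemma sum_codeg0: "y \<in> Y \<Longrightarrow> (\<Sum>z\<in>Y. codeg0 y z) = 0" "y \<in> Y \<Longrightarrow> (\<Sum>z\<in>Y. codeg0 z y) = 0"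
proof -
  show 1: "(\<Sum>z\<in>Y. codeg0 y z) = 0" if "y \<in> Y" for y
    using card_Y_pos sum_codeg[OF that] by (simp add: codeg0_def sum_subtractf)
  then show "(\<Sum>z\<in>Y. codeg0 z y) = 0" if "y \<in> Y"
    using that by (simp add: codeg0_def codeg_commute[of _ y])
qed

text \<open>The column sums of \<open>codeg0\<close> vanish, so an eigenfunction for a nonzero
  eigenvalue sums to 0 and is also an eigenfunction of \<open>codeg\<close>. The eigenvalue c d
  would make it constant, hence zero. The eigenvalue 0 is split off because there the sum is not
  forced to vanish.\<close>

lemma codeg0_eigenvalue:
  assumes ys: "distinct ys" "set ys = Y"
    and root: "poly (char_poly (fmat ys ys codeg0)) \<tau> = 0"
  obtains r where "\<tau> = of_real r" "0 \<le> r" "r < real (c * d)"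
proof -
  obtain v where nz: "\<exists>y\<in>Y. v y \<noteq> 0"
    and ev: "\<And>y. y \<in> Y \<Longrightarrow> (\<Sum>z\<in>Y. codeg0 y z * v z) = \<tau> * v y"
    using fmat_eigenfunction[OF ys(1) root] ys(2) by metis
  show thesis
  proof (cases "\<tau> = 0")
    case True
    then show thesis using that[of 0] c_pos d_pos by simp
  next
    case False
    have "\<tau> * (\<Sum>y\<in>Y. v y) = (\<Sum>y\<in>Y. \<Sum>z\<in>Y. codeg0 y z * v z)"
      by (simp add: ev sum_distrib_left)
    also have "\<dots> = (\<Sum>z\<in>Y. \<Sum>y\<in>Y. codeg0 y z * v z)"
      by (rule sum.swap)
    also have "\<dots> = 0"
      by (simp add: sum_codeg0 flip: sum_distrib_right)
    finally have sum0: "(\<Sum>y\<in>Y. v y) = 0" using False by simp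
    have "(\<Sum>z\<in>Y. codeg y z * v z) = \<tau> * v y" if "y \<in> Y" for y
    proof -
      have "(\<Sum>z\<in>Y. codeg0 y z * v z)
          = (\<Sum>z\<in>Y. codeg y z * v z) - of_nat (c * d) / of_nat (card Y) * (\<Sum>z\<in>Y. v z)"
        by (simp only: codeg0_def left_diff_distrib sum_subtractf sum_distrib_left)
      then show ?thesis using ev[OF that] sum0 by simp
    qed
    from codeg_eigenfunction[OF this nz] obtain r where r: "\<tau> = of_real r" "0 \<le> r"
      "r \<le> real (c * d)" "r = real (c * d) \<Longrightarrow> \<exists>k. \<forall>y\<in>Y. v y = k"
      by metis
    have "r \<noteq> real (c * d)"
    proof
      assume "r = real (c * d)"
      then obtain k where k: "\<forall>y\<in>Y. v y = k" using r(4) by blast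
      then have "of_nat (card Y) * k = 0" using sum0 by simp
      then show False using card_Y_pos nz k by simp
    qed
    then show thesis using that r by simp
  qed
qed

text \<open>Write T for \<open>codeg\<close>, T0 for \<open>codeg0\<close> and J for the all-ones
  matrix. Since T0 J = 0, the product of \<alpha> I - \<beta> T0 and \<alpha> I - \<gamma> J is
  \<alpha> (\<alpha> I - \<beta> T), where \<gamma> J is \<beta> times the part removed by
  deflation. The surplus powers of \<alpha> spare a case distinction at \<alpha> = 0.\<close>

lemma fdet_codeg:
  assumes ys: "distinct ys" "set ys = Y"
  shows "\<alpha> ^ Suc (card Y) * fdet ys (\<lambda>y z. \<alpha> * of_bool (y = z) - \<beta> * codeg y z)
    = \<alpha> ^ card Y * (\<alpha> - \<beta> * of_nat (c * d))
      * fdet ys (\<lambda>y z. \<alpha> * of_bool (y = z) - \<beta> * codeg0 y z)"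
proof -
  define \<gamma> where "\<gamma> = \<beta> * of_nat (c * d) / of_nat (card Y)"
  have len: "length ys = card Y" using ys distinct_card by metis
  have "\<alpha> ^ card Y * fdet ys (\<lambda>y z. \<alpha> * of_bool (y = z) - \<beta> * codeg y z)
      = fdet ys (\<lambda>y z. \<alpha> * (\<alpha> * of_bool (y = z) - \<beta> * codeg y z))"
    by (simp add: fdet_scale len)
  also have "fmat ys ys (\<lambda>y z. \<alpha> * (\<alpha> * of_bool (y = z) - \<beta> * codeg y z))
      = fmat ys ys (\<lambda>y z. \<Sum>u\<in>set ys. (\<alpha> * of_bool (y = u) - \<beta> * codeg0 y u) * (\<alpha> * of_bool (u = z) - \<gamma>))"
  proof (rule fmat_cong)
    fix y z assume yz: "y \<in> set ys" "z \<in> set ys"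
    have "(\<Sum>u\<in>Y. (\<alpha> * of_bool (y = u) - \<beta> * codeg0 y u) * (\<alpha> * of_bool (u = z) - \<gamma>))
      = (\<Sum>u\<in>Y. of_bool (y = u) * (\<alpha> * \<alpha> * of_bool (u = z))) - (\<Sum>u\<in>Y. of_bool (y = u) * (\<alpha> * \<gamma>))
      - (\<Sum>u\<in>Y. \<alpha> * \<beta> * codeg0 y u * of_bool (u = z)) + \<beta> * \<gamma> * (\<Sum>u\<in>Y. codeg0 y u)"
      unfolding sum_distrib_left sum.distrib[symmetric] sum_subtractf[symmetric]
      by (intro sum.cong refl) (simp add: algebra_simps)
    also have "\<dots> = \<alpha> * \<alpha> * of_bool (y = z) - \<alpha> * \<gamma> - \<alpha> * \<beta> * codeg0 y z"
      using yz ys finite_Y by (simp add: sum_of_bool_eq_mult sum_codeg0)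
    also have "\<dots> = \<alpha> * (\<alpha> * of_bool (y = z) - \<beta> * codeg y z)"
      by (simp add: codeg0_def \<gamma>_def algebra_simps)
    finally show "\<alpha> * (\<alpha> * of_bool (y = z) - \<beta> * codeg y z)
      = (\<Sum>u\<in>set ys. (\<alpha> * of_bool (y = u) - \<beta> * codeg0 y u) * (\<alpha> * of_bool (u = z) - \<gamma>))"
      using ys by simp
  qed
  also have "det \<dots> = fdet ys (\<lambda>y z. \<alpha> * of_bool (y = z) - \<beta> * codeg0 y z)
      * fdet ys (\<lambda>y z. \<alpha> * of_bool (y = z) - \<gamma>)"
    by (simp add: fdet_mult[OF ys(1)])
  finally have 1: "\<alpha> ^ card Y * fdet ys (\<lambda>y z. \<alpha> * of_bool (y = z) - \<beta> * codeg y z) = \<dots>" .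
  \<comment> \<open>A rank-one perturbation: the one-element list \<open>[()]\<close> reduces its
    determinant to the single entry \<alpha> - \<gamma> \<open>card Y\<close>.\<close>
  have "\<alpha> * fdet ys (\<lambda>y z. \<alpha> * of_bool (y = z) - \<gamma>) = \<alpha> ^ card Y * (\<alpha> - \<beta> * of_nat (c * d))"
    using fdet_sylvester[OF ys(1), of "[()]" \<alpha> "\<lambda>_ _. \<gamma>" "\<lambda>_ _. 1"] ys(2) card_Y_pos
    by (simp add: len det_single fmat_def \<gamma>_def)
  then show ?thesis
    using 1 by (simp add: mult_ac)
qed

subsection \<open>Characteristic polynomials of the arc walks\<close>

lemma E_eq: "E = edges \<union> prod.swap ` edges"
  using bipartite sym_E by (force simp: edges_def image_iff dest: symD)

lemma edges_swap_disjoint: "edges \<inter> prod.swap ` edges = {}"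
  using disjoint by (auto simp: edges_def)

text \<open>An arc from X to Y can be followed only by an arc from Y to X. Listing the edges
  oriented out of X before their reversals turns this into the block shape of
  \<open>fdet_bipartite\<close>, and the inner sum is the two-step transition from one edge to
  another.\<close>

lemma poly_char_poly_walk:
  assumes fs: "distinct fs" "set fs = edges"
    and zero: "\<And>e f. e \<in> edges \<Longrightarrow> f \<in> edges \<Longrightarrow> P e f = 0 \<and> P (prod.swap e) (prod.swap f) = 0"
  shows "poly (char_poly (trans_mat E P)) k = fdet fs (\<lambda>e f. k\<^sup>2 * of_bool (e = f)
    - (\<Sum>g\<in>edges. complex_of_real (P e (prod.swap g)) * complex_of_real (P (prod.swap g) f)))"
proof -
  have fin: "finite E"
    using E_eq finite_edges by (metis finite_UnI finite_imageI)
  have "poly (char_poly (trans_mat E P)) k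
      = fdet (enum_states E) (\<lambda>e f. k * of_bool (e = f) - complex_of_real (P e f))"
    unfolding trans_mat_fmat by (rule poly_char_poly_fmat[OF enum_states(1)[OF fin]])
  also have "\<dots> = fdet (fs @ map prod.swap fs) (\<lambda>e f. k * of_bool (e = f) - complex_of_real (P e f))"
    using edges_swap_disjoint fs
    by (intro fdet_reorder enum_states fin)
      (auto simp: enum_states(2)[OF fin] distinct_map fs E_eq[symmetric])
  also have "\<dots> = fdet fs (\<lambda>e f. k\<^sup>2 * of_bool (e = f)
    - (\<Sum>g\<in>set fs. complex_of_real (P e (prod.swap g)) * complex_of_real (P (prod.swap g) f)))"
    using edges_swap_disjoint zero by (intro fdet_bipartite) (auto simp: fs)
  finally show ?thesis by (simp add: fs)
qed

lemma walk_zero: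
  assumes "e \<in> edges" "f \<in> edges"
  shows "edge_walk E e f = 0 \<and> edge_walk E (prod.swap e) (prod.swap f) = 0"
    "nb_walk E e f = 0 \<and> nb_walk E (prod.swap e) (prod.swap f) = 0"
  using assms disjoint by (auto simp: edges_def edge_walk_def nb_walk_def)

lemma edge_walk_eq:
  assumes "e \<in> edges" "f \<in> edges"
  shows "edge_walk E e (prod.swap f) = of_bool (snd e = snd f) / real d"
    "edge_walk E (prod.swap e) f = of_bool (fst e = fst f) / real c"
  using assms sym_E by (auto simp: edges_def edge_walk_def deg_X deg_Y dest: symD)

text \<open>Backtracking means following an edge by its own reversal, so forbidding it subtracts the
  identity from the relation of sharing an end.\<close>

lemma nb_walk_eq:
  assumes "e \<in> edges" "f \<in> edges"
  shows "nb_walk E e (prod.swap f) = (of_bool (snd e = snd f) - of_bool (e = f)) / (real d - 1)"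
    "nb_walk E (prod.swap e) f = (of_bool (fst e = fst f) - of_bool (e = f)) / (real c - 1)"
  using assms sym_E by (auto simp: edges_def nb_walk_def deg_X deg_Y prod_eq_iff dest: symD)

lemma sum_edges_fst_eq:
  assumes "x \<in> X"
  shows "(\<Sum>g\<in>edges. h (snd g) * of_bool (fst g = x)) = (\<Sum>y\<in>Y. h y * adj x y)"
proof -
  have "(\<Sum>a\<in>X. \<Sum>y\<in>Y. adj a y * (h y * of_bool (a = x)))
      = (\<Sum>a\<in>X. (\<Sum>y\<in>Y. h y * adj a y) * of_bool (a = x))"
    unfolding sum_distrib_right by (simp add: mult_ac)
  also have "\<dots> = (\<Sum>y\<in>Y. h y * adj x y)"
    using assms finite_X by (simp only: sum_of_bool_eq_mult) simp
  finally show ?thesis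
    unfolding sum_edges[of "\<lambda>a b. h b * of_bool (a = x)"] .
qed

text \<open>The intermediate edge must join \<open>snd e\<close> to \<open>fst f\<close>, so it is
  unique if it exists.\<close>

lemma sum_edges_snd_fst:
  assumes "e \<in> edges" "f \<in> edges"
  shows "(\<Sum>g\<in>edges. of_bool (snd e = snd g) * of_bool (fst g = fst f)) = adj (fst f) (snd e)"
proof -
  have "(\<Sum>g\<in>edges. of_bool (snd e = snd g) * of_bool (fst g = fst f))
      = (\<Sum>y\<in>Y. of_bool (snd e = y) * adj (fst f) y)"
    using assms by (intro sum_edges_fst_eq) (auto simp: edges_def)
  also have "\<dots> = adj (fst f) (snd e)"
    using assms finite_Y by (simp only: sum_of_bool_eq_mult) (auto simp: edges_def)
  finally show ?thesis .
qed

lemma sum_edges_fst_fst: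
  assumes "e \<in> edges" "f \<in> edges"
  shows "(\<Sum>g\<in>edges. of_bool (fst e = fst g) * of_bool (fst g = fst f))
    = complex_of_nat c * of_bool (fst e = fst f)"
proof -
  have x: "fst f \<in> X" using assms by (auto simp: edges_def)
  have "(\<Sum>g\<in>edges. of_bool (fst e = fst g) * of_bool (fst g = fst f))
      = (\<Sum>g\<in>edges. of_bool (fst e = fst f) * of_bool (fst g = fst f) :: complex)"
    by (intro sum.cong) auto
  also have "\<dots> = complex_of_nat c * of_bool (fst e = fst f)"
    using sum_edges_fst_eq[OF x, of "\<lambda>_. of_bool (fst e = fst f)"] sum_adj_Y[OF x]
    by (simp flip: sum_distrib_left)
  finally show ?thesis .
qed

lemma sum_edges_adj_fst:
  assumes "f \<in> edges"
  shows "(\<Sum>g\<in>edges. adj (fst g) y * of_bool (fst g = fst f)) = complex_of_nat c * adj (fst f) y"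
proof -
  have x: "fst f \<in> X" using assms by (auto simp: edges_def)
  have "(\<Sum>g\<in>edges. adj (fst g) y * of_bool (fst g = fst f))
      = (\<Sum>g\<in>edges. adj (fst f) y * of_bool (fst g = fst f))"
    by (intro sum.cong) auto
  also have "\<dots> = complex_of_nat c * adj (fst f) y"
    using sum_edges_fst_eq[OF x, of "\<lambda>_. adj (fst f) y"] sum_adj_Y[OF x]
    by (simp flip: sum_distrib_left)
  finally show ?thesis .
qed

text \<open>The two-step entry depends on \<open>e\<close> only through its end in Y. The matrix
  thus factors through Y as \<open>?a\<close> times \<open>?b\<close>, and the reversed product is
  the codegree matrix divided by c d.\<close>

lemma edge_walk_char_poly:
  assumes ys: "distinct ys" "set ys = Y"
  shows "(k\<^sup>2) ^ card Y * poly (char_poly (trans_mat E (edge_walk E))) k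
    = (k\<^sup>2) ^ card edges
      * fdet ys (\<lambda>y z. k\<^sup>2 * of_bool (y = z) - 1 / of_nat (c * d) * codeg y z)"
proof -
  obtain fs where fs: "distinct fs" "set fs = edges"
    using finite_distinct_list[OF finite_edges] by blast
  have len: "length fs = card edges" "length ys = card Y"
    using fs ys distinct_card by metis+
  let ?a = "\<lambda>e y. of_bool (snd e = y)" and ?b = "\<lambda>y f. adj (fst f) y / of_nat (c * d)"
  have "poly (char_poly (trans_mat E (edge_walk E))) k = fdet fs (\<lambda>e f. k\<^sup>2 * of_bool (e = f)
    - (\<Sum>g\<in>edges. complex_of_real (edge_walk E e (prod.swap g))
        * complex_of_real (edge_walk E (prod.swap g) f)))"
    by (intro poly_char_poly_walk fs walk_zero)
  also have "\<dots> = fdet fs (\<lambda>e f. k\<^sup>2 * of_bool (e = f) - (\<Sum>y\<in>set ys. ?a e y * ?b y f))"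
  proof (intro arg_cong[of _ _ det] fmat_cong arg_cong2[of _ _ _ _ minus] refl)
    fix e f assume "e \<in> set fs" "f \<in> set fs"
    then have ef: "e \<in> edges" "f \<in> edges" "snd e \<in> Y" by (auto simp: fs edges_def)
    have "(\<Sum>g\<in>edges. complex_of_real (edge_walk E e (prod.swap g))
          * complex_of_real (edge_walk E (prod.swap g) f))
        = (\<Sum>g\<in>edges. of_bool (snd e = snd g) * of_bool (fst g = fst f) / of_nat (c * d))"
      using ef by (intro sum.cong) (simp_all add: edge_walk_eq mult.commute)
    also have "\<dots> = adj (fst f) (snd e) / of_nat (c * d)"
      using ef by (simp add: sum_edges_snd_fst flip: sum_divide_distrib)
    also have "\<dots> = (\<Sum>y\<in>set ys. ?a e y * ?b y f)"
      using ef finite_Y by (simp only: sum_of_bool_eq_mult ys) simp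
    finally show "(\<Sum>g\<in>edges. complex_of_real (edge_walk E e (prod.swap g))
          * complex_of_real (edge_walk E (prod.swap g) f)) = (\<Sum>y\<in>set ys. ?a e y * ?b y f)" .
  qed
  finally have 1: "(k\<^sup>2) ^ card Y * poly (char_poly (trans_mat E (edge_walk E))) k
      = (k\<^sup>2) ^ card edges * fdet ys (\<lambda>y z. k\<^sup>2 * of_bool (y = z) - (\<Sum>e\<in>set fs. ?b y e * ?a e z))"
    using fdet_sylvester[OF fs(1) ys(1), of "k\<^sup>2" ?a ?b] by (simp only: len)
  have "(\<Sum>e\<in>set fs. ?b y e * ?a e z) = 1 / of_nat (c * d) * codeg y z" if "z \<in> Y" for y z
    using sum_edges_snd_eq[OF that, of "\<lambda>x. adj x y / of_nat (c * d)"]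
    by (simp add: fs codeg_def sum_distrib_left)
  then show ?thesis
    unfolding 1 by (intro arg_cong2[of _ _ _ _ times] arg_cong[of _ _ det] fmat_cong refl)
      (simp add: ys)
qed

text \<open>The factor \<open>s\<close> clears the denominators of the two-step matrix, so that
  \<kappa> + 1 = \<open>s\<close> \<open>k\<close>^2 is what multiplies the codegrees. The powers on
  the left come from scaling, from the determinant of the auxiliary matrix \<open>?G\<close> and
  from Sylvester's identity; some of them vanish at particular \<open>k\<close>, so they are not
  divided out here.\<close>

lemma nb_walk_char_poly:
  fixes k :: complex
  assumes ys: "distinct ys" "set ys = Y" and c: "c \<ge> 2" and d: "d \<ge> 2"
  defines "s \<equiv> of_nat ((c - 1) * (d - 1))"
  defines "\<kappa> \<equiv> s * k\<^sup>2 - 1"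
  shows "s ^ card edges * (\<kappa> + of_nat c) ^ card edges * \<kappa> ^ card X
      * (\<kappa> * (\<kappa> + of_nat c)) ^ card Y * poly (char_poly (trans_mat E (nb_walk E))) k
    = (\<kappa> * (\<kappa> + of_nat c)) ^ card edges * (\<kappa> + of_nat c) ^ card X
      * fdet ys (\<lambda>y z. (\<kappa> + of_nat c) * (\<kappa> + of_nat d) * of_bool (y = z) - (\<kappa> + 1) * codeg y z)"
proof -
  obtain fs where fs: "distinct fs" "set fs = edges"
    using finite_distinct_list[OF finite_edges] by blast
  obtain xs where xs: "distinct xs" "set xs = X"
    using finite_distinct_list[OF finite_X] by blast
  have len: "length fs = card edges" "length ys = card Y" "length xs = card X"
    using fs ys xs distinct_card by metis+
  let ?N = "\<lambda>e f. \<kappa> * of_bool (e = f) + of_bool (snd e = snd f) + of_bool (fst e = fst f)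
    - adj (fst f) (snd e)"
  let ?G = "\<lambda>e f. (\<kappa> + of_nat c) * of_bool (e = f) - of_bool (fst e = fst f)"
  have s: "s = (of_nat c - 1) * (of_nat d - 1)" "s \<noteq> 0"
    using c d by (simp_all add: s_def of_nat_diff)
  have "s ^ card edges * poly (char_poly (trans_mat E (nb_walk E))) k = fdet fs (\<lambda>e f. s * (k\<^sup>2 * of_bool (e = f)
    - (\<Sum>g\<in>edges. complex_of_real (nb_walk E e (prod.swap g))
        * complex_of_real (nb_walk E (prod.swap g) f))))"
    unfolding fdet_scale len
    by (intro arg_cong2[of _ _ _ _ times] refl poly_char_poly_walk fs walk_zero)
  also have "\<dots> = fdet fs ?N"
  proof (intro arg_cong[of _ _ det] fmat_cong)
    fix e f assume "e \<in> set fs" "f \<in> set fs"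
    then have ef: "e \<in> edges" "f \<in> edges" by (auto simp: fs)
    have "(\<Sum>g\<in>edges. complex_of_real (nb_walk E e (prod.swap g))
          * complex_of_real (nb_walk E (prod.swap g) f))
        = (\<Sum>g\<in>edges. (of_bool (snd e = snd g) - of_bool (e = g))
            * (of_bool (fst g = fst f) - of_bool (g = f)) / s)"
      using ef by (intro sum.cong) (simp_all add: nb_walk_eq s mult.commute)
    also have "\<dots> = ((\<Sum>g\<in>edges. of_bool (snd e = snd g) * of_bool (fst g = fst f))
        - (\<Sum>g\<in>edges. of_bool (snd e = snd g) * of_bool (g = f))
        - (\<Sum>g\<in>edges. of_bool (e = g) * of_bool (fst g = fst f))
        + (\<Sum>g\<in>edges. of_bool (e = g) * of_bool (g = f))) / s"
      unfolding sum_divide_distrib[symmetric] sum_subtractf[symmetric] sum.distrib[symmetric]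
      by (intro arg_cong2[of _ _ _ _ divide] sum.cong refl) (simp add: algebra_simps)
    also have "\<dots> = (adj (fst f) (snd e) - of_bool (snd e = snd f) - of_bool (fst e = fst f)
        + of_bool (e = f)) / s"
      using ef finite_edges by (simp only: sum_edges_snd_fst sum_of_bool_eq_mult) simp
    finally show "s * (k\<^sup>2 * of_bool (e = f)
        - (\<Sum>g\<in>edges. complex_of_real (nb_walk E e (prod.swap g))
          * complex_of_real (nb_walk E (prod.swap g) f))) = ?N e f"
      using s(2) by (simp add: right_diff_distrib \<kappa>_def left_diff_distrib)
  qed
  finally have N: "s ^ card edges * poly (char_poly (trans_mat E (nb_walk E))) k = fdet fs ?N" .
  \<comment> \<open>Sharing an end in X factors through X, and the reversed product is
    \<open>c\<close> times the identity. Passing to X therefore leaves \<kappa> on the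
    diagonal.\<close>
  have G: "(\<kappa> + of_nat c) ^ card X * fdet fs ?G = (\<kappa> + of_nat c) ^ card edges * \<kappa> ^ card X"
  proof -
    let ?a = "\<lambda>e x. of_bool (fst e = x) :: complex" and ?b = "\<lambda>x e. of_bool (fst e = x) :: complex"
    have "fdet fs ?G = fdet fs (\<lambda>e f. (\<kappa> + of_nat c) * of_bool (e = f) - (\<Sum>x\<in>set xs. ?a e x * ?b x f))"
      using finite_X by (intro arg_cong[of _ _ det] fmat_cong)
        (auto simp: fs xs edges_def sum_of_bool_eq_mult)
    then have "(\<kappa> + of_nat c) ^ card X * fdet fs ?G = (\<kappa> + of_nat c) ^ card edges
        * fdet xs (\<lambda>x z. (\<kappa> + of_nat c) * of_bool (x = z) - (\<Sum>e\<in>set fs. ?b x e * ?a e z))"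
      using fdet_sylvester[OF fs(1) xs(1), of "\<kappa> + of_nat c" ?a ?b] by (simp only: len)
    also have "fdet xs (\<lambda>x z. (\<kappa> + of_nat c) * of_bool (x = z) - (\<Sum>e\<in>set fs. ?b x e * ?a e z))
        = fdet xs (\<lambda>x z. \<kappa> * of_bool (x = z))"
    proof (intro arg_cong[of _ _ det] fmat_cong)
      fix x z assume "x \<in> set xs" "z \<in> set xs"
      then have z: "z \<in> X" by (simp add: xs)
      have "(\<Sum>e\<in>set fs. ?b x e * ?a e z) = (\<Sum>e\<in>edges. of_bool (x = z) * of_bool (fst e = z))"
        by (intro sum.cong) (auto simp: fs)
      also have "\<dots> = of_nat c * of_bool (x = z)"
        using sum_edges_fst_eq[OF z, of "\<lambda>_. of_bool (x = z)"] sum_adj_Y[OF z]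
        by (simp flip: sum_distrib_left)
      finally show "(\<kappa> + of_nat c) * of_bool (x = z) - (\<Sum>e\<in>set fs. ?b x e * ?a e z)
          = \<kappa> * of_bool (x = z)"
        by (simp add: algebra_simps)
    qed
    also have "\<dots> = \<kappa> ^ card X"
      by (simp add: fmat_scalar[OF xs(1)] len)
    finally show ?thesis .
  qed
  let ?a = "\<lambda>e y. of_bool (snd e = y)"
  let ?b = "\<lambda>y f. (\<kappa> + 1) * adj (fst f) y - (\<kappa> + of_nat c) * of_bool (snd f = y)"
  \<comment> \<open>\<open>?G\<close> is chosen so that its product with \<kappa> I plus the
    relation of sharing an end in X is the scalar \<kappa> (\<kappa> + \<open>c\<close>). Everything
    else in \<open>?N\<close> sees \<open>e\<close> only through \<open>snd e\<close>, which gives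
    the factorization \<open>?a\<close>, \<open>?b\<close> through Y.\<close>
  have "fdet fs ?N * fdet fs ?G = fdet fs (\<lambda>e f. \<Sum>g\<in>set fs. ?N e g * ?G g f)"
    by (rule fdet_mult[OF fs(1)])
  also have "\<dots> = fdet fs (\<lambda>e f. \<kappa> * (\<kappa> + of_nat c) * of_bool (e = f) - (\<Sum>y\<in>set ys. ?a e y * ?b y f))"
  proof (intro arg_cong[of _ _ det] fmat_cong)
    fix e f assume "e \<in> set fs" "f \<in> set fs"
    then have ef: "e \<in> edges" "f \<in> edges" "snd e \<in> Y" by (auto simp: fs edges_def)
    have "(\<Sum>g\<in>edges. ?N e g * ?G g f) = (\<Sum>g\<in>edges. ?N e g * (\<kappa> + of_nat c) * of_bool (g = f))
      - (\<kappa> * (\<Sum>g\<in>edges. of_bool (e = g) * of_bool (fst g = fst f))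
        + (\<Sum>g\<in>edges. of_bool (snd e = snd g) * of_bool (fst g = fst f))
        + (\<Sum>g\<in>edges. of_bool (fst e = fst g) * of_bool (fst g = fst f))
        - (\<Sum>g\<in>edges. adj (fst g) (snd e) * of_bool (fst g = fst f)))"
      unfolding sum_distrib_left sum_subtractf[symmetric] sum.distrib[symmetric]
      by (intro sum.cong refl) (simp add: algebra_simps)
    also have "\<dots> = ?N e f * (\<kappa> + of_nat c) - (\<kappa> * of_bool (fst e = fst f) + adj (fst f) (snd e)
        + of_nat c * of_bool (fst e = fst f) - of_nat c * adj (fst f) (snd e))"
      using ef finite_edges
      by (simp only: sum_of_bool_eq_mult sum_edges_snd_fst sum_edges_fst_fst sum_edges_adj_fst) simp
    also have "\<dots> = \<kappa> * (\<kappa> + of_nat c) * of_bool (e = f) - ?b (snd e) f"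
      by (simp add: algebra_simps eq_commute[of "snd f"])
    also have "?b (snd e) f = (\<Sum>y\<in>set ys. ?a e y * ?b y f)"
      using ef finite_Y by (simp only: sum_of_bool_eq_mult ys) simp
    finally show "(\<Sum>g\<in>set fs. ?N e g * ?G g f)
      = \<kappa> * (\<kappa> + of_nat c) * of_bool (e = f) - (\<Sum>y\<in>set ys. ?a e y * ?b y f)"
      by (simp only: fs)
  qed
  finally have NG: "(\<kappa> * (\<kappa> + of_nat c)) ^ card Y * (fdet fs ?N * fdet fs ?G)
      = (\<kappa> * (\<kappa> + of_nat c)) ^ card edges * fdet ys (\<lambda>y z. \<kappa> * (\<kappa> + of_nat c) * of_bool (y = z)
        - (\<Sum>e\<in>set fs. ?b y e * ?a e z))"
    using fdet_sylvester[OF fs(1) ys(1), of "\<kappa> * (\<kappa> + of_nat c)" ?a ?b] by (simp only: len)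
  also have "fdet ys (\<lambda>y z. \<kappa> * (\<kappa> + of_nat c) * of_bool (y = z) - (\<Sum>e\<in>set fs. ?b y e * ?a e z))
      = fdet ys (\<lambda>y z. (\<kappa> + of_nat c) * (\<kappa> + of_nat d) * of_bool (y = z) - (\<kappa> + 1) * codeg y z)"
  proof (intro arg_cong[of _ _ det] fmat_cong)
    fix y z assume "y \<in> set ys" "z \<in> set ys"
    then have z: "z \<in> Y" by (simp add: ys)
    have "(\<Sum>e\<in>set fs. ?b y e * ?a e z)
        = (\<kappa> + 1) * (\<Sum>e\<in>edges. adj (fst e) y * of_bool (snd e = z))
        - (\<kappa> + of_nat c) * (\<Sum>e\<in>edges. of_bool (y = z) * of_bool (snd e = z))"
      unfolding sum_distrib_left sum_subtractf[symmetric] fs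
      by (intro sum.cong refl) (auto simp: algebra_simps)
    also have "\<dots> = (\<kappa> + 1) * codeg y z - (\<kappa> + of_nat c) * (of_bool (y = z) * of_nat d)"
      unfolding sum_edges_snd_eq[OF z, of "\<lambda>x. adj x y"] codeg_def
        sum_edges_snd_eq[OF z, of "\<lambda>_. of_bool (y = z)"]
      by (simp only: sum_distrib_left[symmetric] sum_adj_X[OF z])
    finally show "\<kappa> * (\<kappa> + of_nat c) * of_bool (y = z) - (\<Sum>e\<in>set fs. ?b y e * ?a e z)
      = (\<kappa> + of_nat c) * (\<kappa> + of_nat d) * of_bool (y = z) - (\<kappa> + 1) * codeg y z"
      by (simp add: algebra_simps)
  qed
  finally have NG: "(\<kappa> * (\<kappa> + of_nat c)) ^ card Y * (fdet fs ?N * fdet fs ?G)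
      = (\<kappa> * (\<kappa> + of_nat c)) ^ card edges
        * fdet ys (\<lambda>y z. (\<kappa> + of_nat c) * (\<kappa> + of_nat d) * of_bool (y = z) - (\<kappa> + 1) * codeg y z)" .
  have "s ^ card edges * (\<kappa> + of_nat c) ^ card edges * \<kappa> ^ card X
      * (\<kappa> * (\<kappa> + of_nat c)) ^ card Y * poly (char_poly (trans_mat E (nb_walk E))) k
    = (\<kappa> * (\<kappa> + of_nat c)) ^ card Y * (s ^ card edges * poly (char_poly (trans_mat E (nb_walk E))) k)
      * ((\<kappa> + of_nat c) ^ card edges * \<kappa> ^ card X)"
    by (simp only: mult_ac)
  also have "\<dots> = (\<kappa> * (\<kappa> + of_nat c)) ^ card Y * (fdet fs ?N * fdet fs ?G) * (\<kappa> + of_nat c) ^ card X"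
    unfolding N G[symmetric] by (simp only: mult_ac)
  finally show ?thesis
    unfolding NG by (simp only: mult_ac)
qed

section \<open>Closed formulas for the two Kemeny constants\<close>

lemma codeg0_spectrum:
  assumes ys: "distinct ys" "set ys = Y"
  obtains rs where "length rs = card Y" "\<And>r. r \<in> set rs \<Longrightarrow> 0 \<le> r \<and> r < real (c * d)"
    "\<And>\<alpha> \<beta>. fdet ys (\<lambda>y z. \<alpha> * of_bool (y = z) - \<beta> * codeg0 y z)
      = (\<Prod>r\<leftarrow>rs. \<alpha> - \<beta> * complex_of_real r)"
proof -
  have len: "length ys = card Y" using ys distinct_card by metis
  obtain ts where ts: "char_poly (fmat ys ys codeg0) = (\<Prod>t\<leftarrow>ts. [:- t, 1:])" "length ts = card Y"
    using char_poly_factorized[OF fmat_carrier[of ys ys codeg0]] len by auto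
  have real: "\<exists>r. t = of_real r \<and> 0 \<le> r \<and> r < real (c * d)" if "t \<in> set ts" for t
    using codeg0_eigenvalue[OF ys, of t] that
    by (auto simp: ts poly_prod_list prod_list_zero_iff)
  have "map (\<lambda>t. complex_of_real (Re t)) ts = ts"
    by (rule map_idI) (use real in fastforce)
  then have ts_Re: "ts = map complex_of_real (map Re ts)"
    by (simp add: o_def)
  show thesis
  proof (rule that[of "map Re ts"])
    show "0 \<le> r \<and> r < real (c * d)" if "r \<in> set (map Re ts)" for r
      using real that by fastforce
    show "fdet ys (\<lambda>y z. \<alpha> * of_bool (y = z) - \<beta> * codeg0 y z)
      = (\<Prod>r\<leftarrow>map Re ts. \<alpha> - \<beta> * complex_of_real r)" for \<alpha> \<beta>
      unfolding fdet_linear_factor[OF ys(1) ts(1) ts(2)[folded len]]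
      by (subst ts_Re) (simp add: o_def)
  qed (simp add: ts)
qed

text \<open>Here \<open>S\<close> runs over all eigenvalues of the deflated matrix, including the 0
  that replaces the Perron eigenvalue. It exceeds the sum over the non-Perron eigenvalues by 1/(c
  d), which is why its lower bound has \<open>card Y\<close> instead of \<open>card Y\<close> -
  1.\<close>

lemma kemeny_formulas:
  assumes c: "c \<ge> 2" and d: "d \<ge> 2" and cd: "(c, d) \<noteq> (2, 2)"
  defines "s \<equiv> (real c - 1) * (real d - 1)"
  obtains S where
    "S \<ge> real (card Y) / real (c * d)"
    "kemeny_e E = 2 * real (card edges) - 2 * real (card Y) - 3 / 2 + 2 * real (c * d) * S"
    "kemeny_nb E = (real (card edges) - real (card X) - real (card Y) + 1) * (2 * s / (s - 1))
      + (real (card X) - real (card Y) - 1) * (2 * s / (s + real c - 1))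
      - 2 * s / (s + real d - 1) + 1 / 2 + 2 * real (card Y) + 2 * (s - 1) * S"
proof -
  obtain ys where ys: "distinct ys" "set ys = Y"
    using finite_distinct_list[OF finite_Y] by blast
  obtain rs where rs: "length rs = card Y" "\<And>r. r \<in> set rs \<Longrightarrow> 0 \<le> r \<and> r < real (c * d)"
    and det0: "\<And>\<alpha> \<beta>. fdet ys (\<lambda>y z. \<alpha> * of_bool (y = z) - \<beta> * codeg0 y z)
      = (\<Prod>r\<leftarrow>rs. \<alpha> - \<beta> * complex_of_real r)"
    by (rule codeg0_spectrum[OF ys]) (rule that)
  define S where "S = (\<Sum>r\<leftarrow>rs. 1 / (real (c * d) - r))"
  define z where "z = complex_of_real s"
  define n where "n = complex_of_nat (c * d)"
  have n: "n = of_real (real (c * d))" "n \<noteq> 0" using c_pos d_pos by (simp_all add: n_def)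
  \<comment> \<open>For (2,2), the even cycles, \<kappa> would be \<open>k\<close>^2 - 1 and vanish
    at 1. Otherwise \<kappa> has the positive value \<open>s - 1\<close> there.\<close>
  have s1: "s > 1"
  proof -
    have "c \<ge> 3 \<or> d \<ge> 3" using c d cd by auto
    then have "(c - 1) * (d - 1) \<ge> 2"
      using c d mult_le_mono[of 2 "c - 1" 1 "d - 1"] mult_le_mono[of 1 "c - 1" 2 "d - 1"] by auto
    then have "real ((c - 1) * (d - 1)) \<ge> 2" by linarith
    then show ?thesis using c d by (simp add: s_def of_nat_diff)
  qed
  have z: "z = of_nat ((c - 1) * (d - 1))" "z \<noteq> 0" "z - 1 \<noteq> 0" "z \<noteq> 1"
    using c d s1 by (auto simp: z_def s_def of_nat_diff complex_eq_iff)
  have ncd: "n - z = of_nat c + of_nat d - 1"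
    by (simp add: z_def s_def n_def algebra_simps)
  have S_ge: "S \<ge> real (card Y) / real (c * d)"
  proof -
    have "(\<Sum>r\<leftarrow>rs. 1 / real (c * d)) \<le> S"
      unfolding S_def using rs(2) by (intro sum_list_mono frac_le) auto
    then show ?thesis by (simp add: sum_list_triv rs(1))
  qed

  let ?q = "card Y" and ?p = "card X" and ?m = "card edges"
  let ?pe = "char_poly (trans_mat E (edge_walk E))"
  let ?pn = "char_poly (trans_mat E (nb_walk E))"
  have char_poly_nz: "char_poly (trans_mat E P) \<noteq> 0" for P
    using degree_monic_char_poly[of "trans_mat E P" "length (enum_states E)"]
    by (auto simp: trans_mat_fmat)

  let ?X2 = "[:0, 0, 1:] :: complex poly"
  let ?ft = "\<lambda>t. [:- (t / n), 0, 1:]"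
  \<comment> \<open>The surplus powers stay on both sides and cancel after
    \<open>kemeny_poly\<close> is applied, where each factor \<open>?X2\<close> counts 2 for its
    double root 0.\<close>
  have "poly (?pe * ?X2 ^ ?q * ?X2 ^ Suc ?q) k
      = poly (?X2 ^ ?m * ?X2 ^ ?q * [:- 1, 0, 1:] * (\<Prod>t\<leftarrow>map complex_of_real rs. ?ft t)) k" for k
  proof -
    have X2: "poly ?X2 k = k\<^sup>2" by (simp add: power2_eq_square)
    have "poly (?pe * ?X2 ^ ?q * ?X2 ^ Suc ?q) k = (k\<^sup>2) ^ Suc ?q * ((k\<^sup>2) ^ ?q * poly ?pe k)"
      by (simp only: poly_mult poly_power X2 mult_ac)
    also have "\<dots> = (k\<^sup>2) ^ ?m * ((k\<^sup>2) ^ Suc ?q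
        * fdet ys (\<lambda>y z. k\<^sup>2 * of_bool (y = z) - 1 / of_nat (c * d) * codeg y z))"
      unfolding edge_walk_char_poly[OF ys] by (simp only: mult_ac)
    also have "\<dots> = (k\<^sup>2) ^ ?m * ((k\<^sup>2) ^ ?q * (k\<^sup>2 - 1) * (\<Prod>r\<leftarrow>rs. k\<^sup>2 - 1 / n * complex_of_real r))"
      unfolding fdet_codeg[OF ys] det0 using n by (simp add: n_def)
    also have "(\<Prod>r\<leftarrow>rs. k\<^sup>2 - 1 / n * complex_of_real r) = poly (\<Prod>t\<leftarrow>map complex_of_real rs. ?ft t) k"
      by (simp add: poly_prod_list o_def power2_eq_square)
    finally show ?thesis
      by (simp only: poly_mult poly_power X2) (simp add: power2_eq_square)
  qed
  then have "?pe * ?X2 ^ ?q * ?X2 ^ Suc ?q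
      = ?X2 ^ ?m * ?X2 ^ ?q * [:- 1, 0, 1:] * (\<Prod>t\<leftarrow>map complex_of_real rs. ?ft t)"
    by (intro poly_eq_poly_eq_iff[THEN iffD1] ext)
  then have "kemeny_poly (?pe * ?X2 ^ ?q * ?X2 ^ Suc ?q)
      = kemeny_poly (?X2 ^ ?m * ?X2 ^ ?q * [:- 1, 0, 1:] * (\<Prod>t\<leftarrow>map complex_of_real rs. ?ft t))"
    by (rule arg_cong)
  moreover have "(\<Prod>t\<leftarrow>map complex_of_real rs. ?ft t) \<noteq> 0"
    by (auto simp: prod_list_zero_iff)
  moreover have X2: "kemeny_poly ?X2 = 2"
    by (simp add: kemeny_poly_even_quadratic)
  ultimately have e: "kemeny_poly ?pe + of_nat ?q * 2 + of_nat (Suc ?q) * 2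
      = of_nat ?m * 2 + of_nat ?q * 2 + 1 / 2 + kemeny_poly (\<Prod>t\<leftarrow>map complex_of_real rs. ?ft t)"
    by (simp only: kemeny_poly_mult kemeny_poly_power kemeny_poly_square_minus_one char_poly_nz X2
        mult_eq_0_iff power_eq_0_iff pCons_eq_0_iff zero_neq_one one_neq_zero simp_thms)
  have "kemeny_poly (\<Prod>t\<leftarrow>map complex_of_real rs. ?ft t)
      = (\<Sum>t\<leftarrow>map complex_of_real rs. kemeny_poly (?ft t))"
    by (subst kemeny_poly_prod_list) (auto simp: o_def)
  also have "\<dots> = complex_of_real (real (length rs) * 0 + 2 * real (c * d) * S)"
    unfolding S_def
  proof (rule sum_list_map_of_real)
    fix r assume "r \<in> set rs"
    then have r: "r < real (c * d)" using rs by blast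
    then have pos: "1 - r / real (c * d) > 0"
      using c_pos d_pos by (simp add: field_simps)
    have eq: "- (complex_of_real r / n) + 1 = complex_of_real (1 - r / real (c * d))"
      by (simp add: n(1))
    have "kemeny_poly (?ft (complex_of_real r)) = 2 * 1 / (- (complex_of_real r / n) + 1)"
      by (rule kemeny_poly_even_quadratic) (unfold eq of_real_eq_0_iff, use pos in linarith)
    also have "\<dots> = complex_of_real (2 * 1 / (1 - r / real (c * d)))"
      unfolding eq by simp
    also have "2 * 1 / (1 - r / real (c * d)) = 0 + 2 * real (c * d) * (1 / (real (c * d) - r))"
      using r c_pos d_pos by (simp add: field_simps)
    finally show "kemeny_poly (?ft (complex_of_real r))
        = complex_of_real (0 + 2 * real (c * d) * (1 / (real (c * d) - r)))" .
  qed
  finally have ft: "kemeny_poly (\<Prod>t\<leftarrow>map complex_of_real rs. ?ft t)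
      = complex_of_real (real (length rs) * 0 + 2 * real (c * d) * S)" .
  have ke: "kemeny_e E = 2 * real ?m - 2 * real ?q - 3 / 2 + 2 * real (c * d) * S"
    using arg_cong[OF e[unfolded ft], of Re]
    by (simp add: kemeny_e_def kemeny_eq_kemeny_poly algebra_simps)

  let ?K = "[:- 1, 0, z:]" and ?Kc = "[:of_nat c - 1, 0, z:]" and ?Kd = "[:of_nat d - 1, 0, z:]"
  \<comment> \<open>This is (\<kappa> + c)(\<kappa> + d) - (\<kappa> + 1) \<open>t\<close> as a
    polynomial in \<open>k\<close>, since \<kappa> + 1 is \<open>z\<close> times the square of
    \<open>k\<close>.\<close>
  let ?h = "\<lambda>t. ?Kc * ?Kd - [:0, 0, z * t:]"
  have "poly (?pn * [:z:] ^ ?m * ?Kc ^ ?m * ?K ^ ?p * (?K * ?Kc) ^ ?q * (?Kc * ?Kd) ^ Suc ?q) k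
      = poly ((?K * ?Kc) ^ ?m * ?Kc ^ ?p * (?Kc * ?Kd) ^ ?q * (?K * [:z:] * [:- 1, 0, 1:])
          * (\<Prod>t\<leftarrow>map complex_of_real rs. ?h t)) k" for k
  proof -
    define \<kappa> where "\<kappa> = z * k\<^sup>2 - 1"
    have K: "poly ?K k = \<kappa>" "poly ?Kc k = \<kappa> + of_nat c" "poly ?Kd k = \<kappa> + of_nat d"
      "poly [:z:] k = z"
      by (simp_all add: \<kappa>_def power2_eq_square)
    have h: "poly (?h t) k = (\<kappa> + of_nat c) * (\<kappa> + of_nat d) - (\<kappa> + 1) * t" for t
      unfolding poly_diff poly_mult K by (simp add: \<kappa>_def power2_eq_square)
    \<comment> \<open>The Perron eigenvalue t = c d makes the quartic factor split: its constant
      term in \<kappa> cancels, and \<kappa> + c + d - c d is a multiple of \<open>k\<close>^2 -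
      1.\<close>
    have n': "(\<kappa> + of_nat c) * (\<kappa> + of_nat d) - (\<kappa> + 1) * n = \<kappa> * z * poly [:- 1, 0, 1:] k"
    proof -
      have "(\<kappa> + of_nat c) * (\<kappa> + of_nat d) - (\<kappa> + 1) * n = \<kappa> * (\<kappa> + of_nat c + of_nat d - n)"
        by (simp add: n_def algebra_simps)
      also have "\<kappa> + of_nat c + of_nat d - n = z * poly [:- 1, 0, 1:] k"
        using ncd by (simp add: \<kappa>_def power2_eq_square algebra_simps)
      finally show ?thesis by simp
    qed
    have "poly (?pn * [:z:] ^ ?m * ?Kc ^ ?m * ?K ^ ?p * (?K * ?Kc) ^ ?q * (?Kc * ?Kd) ^ Suc ?q) k
      = ((\<kappa> + of_nat c) * (\<kappa> + of_nat d)) ^ Suc ?q * (z ^ ?m * (\<kappa> + of_nat c) ^ ?m * \<kappa> ^ ?p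
          * (\<kappa> * (\<kappa> + of_nat c)) ^ ?q * poly ?pn k)"
      unfolding poly_mult poly_power K by (simp only: mult_ac)
    also have "\<dots> = (\<kappa> * (\<kappa> + of_nat c)) ^ ?m * (\<kappa> + of_nat c) ^ ?p
        * (((\<kappa> + of_nat c) * (\<kappa> + of_nat d)) ^ Suc ?q
          * fdet ys (\<lambda>y z. (\<kappa> + of_nat c) * (\<kappa> + of_nat d) * of_bool (y = z) - (\<kappa> + 1) * codeg y z))"
      unfolding nb_walk_char_poly[OF ys c d, of k, folded z(1), folded \<kappa>_def] by (simp only: mult_ac)
    also have "\<dots> = (\<kappa> * (\<kappa> + of_nat c)) ^ ?m * (\<kappa> + of_nat c) ^ ?p
        * (((\<kappa> + of_nat c) * (\<kappa> + of_nat d)) ^ ?q * (\<kappa> * z * poly [:- 1, 0, 1:] k)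
          * (\<Prod>r\<leftarrow>rs. (\<kappa> + of_nat c) * (\<kappa> + of_nat d) - (\<kappa> + 1) * complex_of_real r))"
      unfolding fdet_codeg[OF ys] det0 n_def[symmetric] n' ..
    also have "(\<Prod>r\<leftarrow>rs. (\<kappa> + of_nat c) * (\<kappa> + of_nat d) - (\<kappa> + 1) * complex_of_real r)
        = poly (\<Prod>t\<leftarrow>map complex_of_real rs. ?h t) k"
      unfolding poly_prod_list map_map o_def h ..
    finally show ?thesis
      unfolding poly_mult poly_power K by (simp only: mult_ac)
  qed
  then have "?pn * [:z:] ^ ?m * ?Kc ^ ?m * ?K ^ ?p * (?K * ?Kc) ^ ?q * (?Kc * ?Kd) ^ Suc ?q
      = (?K * ?Kc) ^ ?m * ?Kc ^ ?p * (?Kc * ?Kd) ^ ?q * (?K * [:z:] * [:- 1, 0, 1:])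
          * (\<Prod>t\<leftarrow>map complex_of_real rs. ?h t)"
    by (intro poly_eq_poly_eq_iff[THEN iffD1] ext)
  then have eq: "kemeny_poly (?pn * [:z:] ^ ?m * ?Kc ^ ?m * ?K ^ ?p * (?K * ?Kc) ^ ?q * (?Kc * ?Kd) ^ Suc ?q)
      = kemeny_poly ((?K * ?Kc) ^ ?m * ?Kc ^ ?p * (?Kc * ?Kd) ^ ?q * (?K * [:z:] * [:- 1, 0, 1:])
          * (\<Prod>t\<leftarrow>map complex_of_real rs. ?h t))"
    by (rule arg_cong)
  define lK lc ld where "lK = kemeny_poly ?K" and "lc = kemeny_poly ?Kc" and "ld = kemeny_poly ?Kd"
  \<comment> \<open>At 1 the factors \<kappa> + c and \<kappa> + d equal (c-1) d and (d-1) c, with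
    product s c d. Dividing the two values gives 2 + 2 (s-1) / (c d - r), again affine in the
    summand of \<open>S\<close>.\<close>
  have h1: "poly (?h (complex_of_real r)) 1 = complex_of_real (s * (real (c * d) - r))"
    and h2: "poly (pderiv (?h (complex_of_real r))) 1
      = complex_of_real (2 * s * (real (c * d) - r + (s - 1)))" for r
     apply (simp_all add: pderiv_diff pderiv_mult pderiv_pCons z_def s_def del: mult_pCons_left mult_pCons_right)
     apply (simp_all add: algebra_simps)
    done
  have h_nz: "poly (?h (complex_of_real r)) 1 \<noteq> 0" if "r \<in> set rs" for r
    unfolding h1 of_real_eq_0_iff using rs(2)[OF that] s1 by simp
  then have h_nz': "0 \<notin> set (map ?h (map complex_of_real rs))"
    unfolding map_map by (intro zero_notin_set_map_poly) (simp only: o_def)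
  then have prod_nz: "(\<Prod>t\<leftarrow>map complex_of_real rs. ?h t) \<noteq> 0"
    unfolding prod_list_zero_iff .
  have nz: "?K \<noteq> 0" "?Kc \<noteq> 0" "?Kd \<noteq> 0" "[:z:] \<noteq> 0" "[:- 1, 0, 1 :: complex:] \<noteq> 0"
    using z by auto
  \<comment> \<open>Solved for the first term, \<open>lK\<close> gets the coefficient m - p - q + 1,
    the cycle rank of the graph, \<open>lc\<close> gets p - q - 1 and \<open>ld\<close> gets -1. The
    last is negative and the one before can be, so the factors cannot all be gathered on one side as
    powers.\<close>
  have nb: "kemeny_poly ?pn + of_nat ?m * 0 + of_nat ?m * lc + of_nat ?p * lK + of_nat ?q * (lK + lc)
        + of_nat (Suc ?q) * (lc + ld)
      = of_nat ?m * (lK + lc) + of_nat ?p * lc + of_nat ?q * (lc + ld) + (lK + 0 + 1 / 2)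
        + kemeny_poly (\<Prod>t\<leftarrow>map complex_of_real rs. ?h t)"
    using eq unfolding lK_def lc_def ld_def
    by (simp only: kemeny_poly_mult kemeny_poly_power kemeny_poly_square_minus_one char_poly_nz
        kemeny_poly_const[OF z(2)] nz prod_nz mult_eq_0_iff power_eq_0_iff simp_thms)
  have ht: "kemeny_poly (\<Prod>t\<leftarrow>map complex_of_real rs. ?h t)
      = complex_of_real (real (length rs) * 2 + 2 * (s - 1) * S)"
  proof -
    have "kemeny_poly (\<Prod>t\<leftarrow>map complex_of_real rs. ?h t)
        = (\<Sum>t\<leftarrow>map complex_of_real rs. kemeny_poly (?h t))"
      by (subst kemeny_poly_prod_list[OF h_nz']) (simp add: o_def)
    also have "\<dots> = complex_of_real (real (length rs) * 2 + 2 * (s - 1) * S)"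
      unfolding S_def
    proof (rule sum_list_map_of_real)
      fix r assume r: "r \<in> set rs"
      have "real (c * d) - r > 0" using rs(2)[OF r] by simp
      then have "2 * s * (real (c * d) - r + (s - 1)) / (s * (real (c * d) - r))
          = 2 + 2 * (s - 1) * (1 / (real (c * d) - r))"
        using s1 by (simp add: field_simps)
      then show "kemeny_poly (?h (complex_of_real r))
          = complex_of_real (2 + 2 * (s - 1) * (1 / (real (c * d) - r)))"
        unfolding kemeny_poly_eq_logderiv[OF h_nz[OF r]] h1 h2 of_real_divide[symmetric] by simp
    qed
    finally show ?thesis .
  qed
  have l: "lK = complex_of_real (2 * s / (s - 1))" "lc = complex_of_real (2 * s / (s + real c - 1))"
      "ld = complex_of_real (2 * s / (s + real d - 1))"
  proof -
    \<comment> \<open>The values 0, c and d of \<open>a\<close> give the factors \<kappa>, \<kappa>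
      + c and \<kappa> + d.\<close>
    have quad: "kemeny_poly [:complex_of_real a - 1, 0, z:] = complex_of_real (2 * s / (s + a - 1))"
      if "a \<ge> 0" for a
    proof -
      have eq: "complex_of_real a - 1 + z = complex_of_real (s + a - 1)"
        by (simp add: z_def)
      have "kemeny_poly [:complex_of_real a - 1, 0, z:] = 2 * z / (complex_of_real a - 1 + z)"
        by (rule kemeny_poly_even_quadratic)
          (unfold eq of_real_eq_0_iff, use s1 that in linarith)
      then show ?thesis
        unfolding eq by (simp add: z_def)
    qed
    show "lK = complex_of_real (2 * s / (s - 1))"
      using quad[of 0] by (simp add: lK_def)
    show "lc = complex_of_real (2 * s / (s + real c - 1))"
      using quad[of "real c"] by (simp add: lc_def)
    show "ld = complex_of_real (2 * s / (s + real d - 1))"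
      using quad[of "real d"] by (simp add: ld_def)
  qed
  have "kemeny_nb E = (real ?m - real ?p - real ?q + 1) * (2 * s / (s - 1))
      + (real ?p - real ?q - 1) * (2 * s / (s + real c - 1))
      - 2 * s / (s + real d - 1) + 1 / 2 + 2 * real ?q + 2 * (s - 1) * S"
  proof -
    define k1 k2 k3 where k: "k1 = 2 * s / (s - 1)" "k2 = 2 * s / (s + real c - 1)"
      "k3 = 2 * s / (s + real d - 1)"
    show ?thesis
      using arg_cong[OF nb[unfolded ht l rs(1)], of Re] unfolding k[symmetric]
      by (simp add: kemeny_nb_def kemeny_eq_kemeny_poly algebra_simps)
  qed
  with S_ge ke show thesis by (rule that)
qed

end

subsection \<open>Arithmetic of the degrees\<close>

text \<open>This is 1 > 1/c + 1/d + 1/W cleared of denominators, the case q = c. For a complete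
  bipartite graph the deflated matrix is zero and the bound on S is attained, so the exclusions are
  genuine: (3,3) gives equality, and (2,3), (2,4), (2,5) reverse the inequality.\<close>

lemma complete_bipartite_ineq:
  fixes c d :: int
  assumes "2 \<le> c" "c \<le> d" "(c, d) \<notin> {(2, 2), (2, 3), (2, 4), (2, 5), (3, 3)}"
  shows "(c * d - c - d) * (c * d - c - d) > c * d"
proof -
  consider "c = 2" "d \<ge> 6" | "c = 3" "d \<ge> 4" | "c \<ge> 4" "d \<ge> 4"
    using assms by force
  then show ?thesis
  proof cases
    case 1
    define j where "j = d - 6"
    with 1 have j: "d = j + 6" "j \<ge> 0" by auto
    have "(c * d - c - d) * (c * d - c - d) - c * d = j * j + 6 * j + 4"
      using 1 j by (simp add: algebra_simps)
    moreover have "j * j \<ge> 0" by simp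
    ultimately show ?thesis using j(2) by linarith
  next
    case 2
    define j where "j = d - 4"
    with 2 have j: "d = j + 4" "j \<ge> 0" by auto
    have "(c * d - c - d) * (c * d - c - d) - c * d = 4 * (j * j) + 17 * j + 13"
      using 2 j by (simp add: algebra_simps)
    moreover have "j * j \<ge> 0" by simp
    ultimately show ?thesis using j(2) by linarith
  next
    case 3
    define i j where "i = c - 4" and "j = d - 4"
    with 3 have cd: "c = i + 4" "d = j + 4" "i \<ge> 0" "j \<ge> 0" by auto
    define t w where "t = i * j" and "w = c * d - c - d"
    have t: "t \<ge> 0" using cd by (simp add: t_def)
    have w: "w = t + 3 * i + 3 * j + 8" and "c * d = t + 4 * i + 4 * j + 16"
      by (simp_all add: w_def cd t_def algebra_simps)
    \<comment> \<open>The number 8 is the value of \<open>w\<close> at c = d = 4, its minimum in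
      this case.\<close>
    then have "c * d < 8 * w" using t cd(3,4) by simp
    also have "\<dots> \<le> w * w"
      using w t cd(3,4) by (intro mult_right_mono) auto
    finally show ?thesis unfolding w_def .
  qed
qed

text \<open>Once q > c, the first factor is at least c (d - 1), and W \<ge> 2 already suffices
  because 2 (d - 1) > d. Only (2,3) has W = 1.\<close>

lemma biregular_ineq_le:
  fixes c d p q :: int
  assumes cd: "2 \<le> c" "c \<le> d" "(c, d) \<noteq> (2, 2)" and q: "c \<le> q" and pq: "q * d = p * c"
    and exc: "q = c \<Longrightarrow> (c, d) \<notin> {(2, 3), (2, 4), (2, 5), (3, 3)}"
  shows "(q * d - c - d) * (c * d - c - d) > c * d"
proof (cases "q = c")
  case True
  then show ?thesis using complete_bipartite_ineq[of c d] cd exc by auto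
next
  case False
  then have "q \<ge> c + 1" using q by simp
  then have "q * d \<ge> (c + 1) * d" using cd by (intro mult_right_mono) auto
  then have qd: "q * d - c - d \<ge> c * (d - 1)" by (simp add: algebra_simps)
  have d3: "d \<ge> 3" using cd by auto
  show ?thesis
  proof (cases "c = 2 \<and> d = 3")
    case True
    \<comment> \<open>Counting edges from both sides makes q even, so q jumps from 2 to at least 4;
      the value q = 3 would not satisfy the inequality.\<close>
    then have "q * 3 = p * 2" "q \<noteq> 2" "q \<ge> 2" using pq False q by auto
    then have "q \<ge> 4" by presburger
    with True show ?thesis by simp
  next
    case F: False
    have W: "c * d - c - d \<ge> 2"
    proof (cases "c = 2")
      case True
      then show ?thesis using F d3 by simp
    next
      case False
      then have "(c - 1) * (d - 1) \<ge> 2 * 2" using cd by (intro mult_mono) auto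
      then show ?thesis by (simp add: algebra_simps)
    qed
    have "c * d < c * (d - 1) * 2"
      using cd d3 by (simp add: algebra_simps)
    also have "\<dots> \<le> (q * d - c - d) * (c * d - c - d)"
    proof (rule mult_mono[OF qd W])
      have "0 \<le> c * (d - 1)" using cd by simp
      then show "0 \<le> q * d - c - d" using qd by linarith
    qed simp
    finally show ?thesis .
  qed
qed

text \<open>Exchanging the parts swaps (c, q) with (d, p) and preserves both q d = p c and the
  inequality, so c \<le> d may be assumed. Integers avoid truncated subtraction.\<close>

lemma biregular_ineq:
  fixes c d p q :: nat
  assumes cd: "2 \<le> c" "2 \<le> d" "(c, d) \<noteq> (2, 2)" and q: "c \<le> q" "d \<le> p" and pq: "p * c = q * d"
    and exc: "q = c \<Longrightarrow> p = d
      \<Longrightarrow> (c, d) \<notin> {(2, 3), (3, 2), (2, 4), (4, 2), (2, 5), (5, 2), (3, 3)}"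
  shows "(real q * real d - real c - real d) * (real c * real d - real c - real d) > real c * real d"
proof -
  have pq': "int q * int d = int p * int c" using pq by (metis of_nat_mult)
  have "q = c \<longleftrightarrow> p = d" using pq cd by (auto simp: mult.commute)
  then have "(int q * int d - int c - int d) * (int c * int d - int c - int d) > int c * int d"
  proof (cases "c \<le> d")
    case True
    then show ?thesis
      using cd q exc \<open>q = c \<longleftrightarrow> p = d\<close> by (intro biregular_ineq_le[OF _ _ _ _ pq']) auto
  next
    case False
    then have "(int p * int c - int d - int c) * (int d * int c - int d - int c) > int d * int c"
      using cd q exc \<open>q = c \<longleftrightarrow> p = d\<close> by (intro biregular_ineq_le[OF _ _ _ _ pq'[symmetric]]) auto
    then show ?thesis using pq' by (simp add: algebra_simps)
  qed
  then have "real_of_int (int c * int d)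
      < real_of_int ((int q * int d - int c - int d) * (int c * int d - int c - int d))"
    by (rule of_int_less_iff[THEN iffD2])
  then show ?thesis by simp
qed

text \<open>With \<open>u\<close> = Q / C the part sizes are u D and u C and the edge count is u C
  D, while the denominators become w, (C-1) D and (D-1) C. The coefficients of \<open>S\<close>
  differ by 2 (C + D), so its lower bound reduces the claim to 1/C + 1/D + 1/w < u, which is
  \<open>ineq\<close> divided by C D w.\<close>

lemma kemeny_difference_pos:
  fixes C D P Q S :: real
  assumes C: "C > 1" and D: "D > 1" and W: "C * D - C - D > 0" and PQ: "P * C = Q * D"
    and S: "S \<ge> Q / (C * D)" and ineq: "(Q * D - C - D) * (C * D - C - D) > C * D"
  defines "s \<equiv> (C - 1) * (D - 1)"
  shows "(P * C - P - Q + 1) * (2 * s / (s - 1)) + (P - Q - 1) * (2 * s / (s + C - 1))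
      - 2 * s / (s + D - 1) + 1 / 2 + 2 * Q + 2 * (s - 1) * S
    < 2 * (P * C) - 2 * Q - 3 / 2 + 2 * (C * D) * S"
proof -
  define w where "w = C * D - C - D"
  define u where "u = Q / C"
  have w: "w > 0" "s = w + 1" using W by (simp_all add: w_def s_def algebra_simps)
  have Q: "Q = u * C" using C by (simp add: u_def)
  have P: "P = u * D" using C PQ by (simp add: u_def field_simps)
  have e1: "2 * s / (s - 1) = 2 + 2 / w" using w by (simp add: field_simps)
  have "s + C - 1 = (C - 1) * D" "s + D - 1 = (D - 1) * C" by (simp_all add: s_def algebra_simps)
  then have e2: "2 * s / (s + C - 1) = 2 - 2 / D" and e3: "2 * s / (s + D - 1) = 2 - 2 / C"
    using C D by (simp_all add: s_def field_simps)
  have "P * C - P - Q + 1 = u * w + 1" by (simp add: P Q w_def algebra_simps)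
  then have f1: "(P * C - P - Q + 1) * (2 * s / (s - 1)) = 2 * u * w + 2 * u + 2 + 2 / w"
    unfolding e1 using w by (simp add: field_simps)
  have f2: "(P - Q - 1) * (2 * s / (s + C - 1)) = 2 * P - 2 * Q - 2 - 2 * u + 2 * Q / D + 2 / D"
    unfolding e2 P using D by (simp add: field_simps)
  have "(C + D) * (Q / (C * D)) \<le> (C + D) * S"
    using C D S by (intro mult_left_mono) auto
  moreover have "(C + D) * (Q / (C * D)) = u + Q / D"
    using C D by (simp add: u_def field_simps)
  ultimately have SS: "(C + D) * S \<ge> u + Q / D" by simp
  have "1 / C + 1 / D + 1 / w < u"
  proof -
    have "C * D / (C * D * w) < (Q * D - C - D) * w / (C * D * w)"
      using ineq C D w by (intro divide_strict_right_mono) (auto simp: w_def)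
    moreover have "C * D / (C * D * w) = 1 / w" using C D by simp
    moreover have "(Q * D - C - D) * w / (C * D * w) = u - 1 / D - 1 / C"
      using C D w by (simp add: u_def field_simps)
    ultimately show ?thesis by simp
  qed
  moreover have "2 * u * w = 2 * (P * C) - 2 * P - 2 * Q"
    by (simp add: P Q w_def algebra_simps)
  moreover have "2 * (s - 1) * S = 2 * (C * D) * S - 2 * ((C + D) * S)"
    by (simp add: w(2) w_def algebra_simps)
  moreover have "2 * Q / D = 2 * (Q / D)" "2 / D = 2 * (1 / D)" "2 / C = 2 * (1 / C)" "2 / w = 2 * (1 / w)"
    by simp_all
  ultimately show ?thesis
    unfolding f1 f2 e3 using SS by linarith
qed

section \<open>Recognising the excluded graphs and the conclusion\<close>

lemma is_complete_bipartite_commute: "is_complete_bipartite m n V E \<Longrightarrow> is_complete_bipartite n m V E"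
  unfolding is_complete_bipartite_def by (metis Int_commute Un_commute)

lemma (in biregular_graph) complete_bipartite:
  assumes "card Y = c" "card X = d"
  shows "is_complete_bipartite d c (X \<union> Y) E"
proof -
  have "(x, y) \<in> E" if "x \<in> X" "y \<in> Y" for x y
  proof -
    have "nbrs E x \<subseteq> Y" "card (nbrs E x) = card Y"
      using that deg_X[of x] assms nbrs_X[of x] by (auto simp: deg_def)
    then have "nbrs E x = Y" using finite_Y by (simp add: card_subset_eq)
    then show ?thesis using that by (auto simp: nbrs_def)
  qed
  then have "E = X \<times> Y \<union> Y \<times> X"
    using bipartite sym_E by (auto dest: symD)
  then show ?thesis
    unfolding is_complete_bipartite_def using assms disjoint by blast
qed

theorem theorem4p4:
  fixes V :: "'a set" and E :: "('a \<times> 'a) set" and c d :: nat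
  assumes "simple_graph V E"
    and "connected_graph V E"
    and "biregular c d V E"
    and "c \<ge> 2" and "d \<ge> 2" and "(c, d) \<noteq> (2, 2)"
    and "\<not> is_complete_bipartite 2 3 V E"
    and "\<not> is_complete_bipartite 2 4 V E"
    and "\<not> is_complete_bipartite 2 5 V E"
    and "\<not> is_complete_bipartite 3 3 V E"
  shows "kemeny_e E > kemeny_nb E"
proof -
  obtain X Y where XY: "X \<union> Y = V" "X \<inter> Y = {}"
    "\<forall>(u, v)\<in>E. (u \<in> X \<and> v \<in> Y) \<or> (u \<in> Y \<and> v \<in> X)"
    "\<forall>x\<in>X. deg E x = c" "\<forall>y\<in>Y. deg E y = d"
    using assms(3) unfolding biregular_def by blast
  interpret biregular_graph X Y E c d
    using assms(1,2,4,5) XY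
    by unfold_locales (auto simp: simple_graph_def connected_graph_def)
  \<comment> \<open>The part of degree c may be either the larger or the smaller one, so each
    excluded graph has to be ruled out in both orders of its parts.\<close>
  have exc: "(c, d) \<notin> {(2, 3), (3, 2), (2, 4), (4, 2), (2, 5), (5, 2), (3, 3)}"
    if "card Y = c" "card X = d"
    using complete_bipartite[OF that] is_complete_bipartite_commute[OF complete_bipartite[OF that]]
      assms(7-10) XY(1) by auto
  have pq: "card X * c = card Y * d" using card_edges by simp
  obtain S where S: "S \<ge> real (card Y) / real (c * d)"
    and ke: "kemeny_e E = 2 * real (card edges) - 2 * real (card Y) - 3 / 2 + 2 * real (c * d) * S"
    and knb: "kemeny_nb E = (real (card edges) - real (card X) - real (card Y) + 1)
        * (2 * ((real c - 1) * (real d - 1)) / ((real c - 1) * (real d - 1) - 1))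
      + (real (card X) - real (card Y) - 1)
        * (2 * ((real c - 1) * (real d - 1)) / ((real c - 1) * (real d - 1) + real c - 1))
      - 2 * ((real c - 1) * (real d - 1)) / ((real c - 1) * (real d - 1) + real d - 1)
      + 1 / 2 + 2 * real (card Y) + 2 * ((real c - 1) * (real d - 1) - 1) * S"
    using kemeny_formulas[OF assms(4-6)] by blast
  have "c + d < c * d"
  proof -
    obtain i j where "c = i + 2" "d = j + 2"
      using assms(4,5) by (metis add.commute le_Suc_ex)
    then show ?thesis using assms(6) by (auto simp: algebra_simps)
  qed
  then have W: "real c * real d - real c - real d > 0"
    by (simp flip: of_nat_mult of_nat_add)
  have m: "real (card edges) = real (card X) * real c"
    by (simp add: card_edges(1))
  have pq': "real (card X) * real c = real (card Y) * real d"
    using pq by (metis of_nat_mult)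
  show ?thesis
    unfolding ke knb m of_nat_mult
    by (rule kemeny_difference_pos[OF _ _ W pq'])
      (use assms(4,5) S biregular_ineq[OF assms(4-6) c_le_card_Y d_le_card_X pq exc] in auto)
qed

end
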